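(* Let $K$ be a field, $S=K[t_1,\ldots,t_s]$, let $\mathcal{L}\subset\mathbb{Z}^s$ be a lattice of rank $s-1$ and let $\alpha_1,\ldots,\alpha_{s-1}$ be a $\mathbb{Z}$-basis of $\mathcal{L}$. Write $\alpha_i=(\alpha_{1,i},\ldots,\alpha_{s,i})$ for $i=1,\ldots,s-1$, and let $B=(\alpha_{j,i})$ be the $s\times(s-1)$ matrix with columns $\alpha_1,\ldots,\alpha_{s-1}$. For $i=1,\ldots,s$ let $v_i=(-1)^i\det(B_i)$, where $B_i$ is the $(s-1)\times(s-1)$ matrix obtained from $B$ by deleting its $i$-th row. Then $$\deg(S/I(\mathcal{L}))=\max\{v_1,\ldots,v_s,0\}-\min\{v_1,\ldots,v_s,0\}.$$
   Context: A lattice is a subgroup $\mathcal{L}$ of $\mathbb{Z}^s$. For $a\in\mathbb{Z}^s$ write $a=a^+-a^-$ with $a^+,a^-\in\mathbb{N}^s$ of disjoint support, and $t^c=t_1^{c_1}\cdots t_s^{c_s}$. The lattice ideal is $I(\mathcal{L})=(t^{a^+}-t^{a^-}\mid a\in\mathcal{L})\subset S$ (not assumed homogeneous). For an ideal $I\subset S$ with $k=\dim(S/I)$ (Krull dimension), the degree is $\deg(S/I)=k!\lim_{i\to\infty}\dim_K(S_{\le i}/I_{\le i})/i^k$, where $S_{\le i}$ (resp. $I_{\le i}$) is the space of polynomials of $S$ (resp. of $I$) of standard total degree at most $i$. *)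

theory Defs
  imports
    "HOL-Algebra.QuotRing"
    "HOL-Library.Extended_Nat"
    "HOL-Library.Poly_Mapping"
    "Jordan_Normal_Form.VS_Connect"
    "Jordan_Normal_Form.DL_Submatrix"
begin

hide_const (open) Multiset.mult

section \<open>The polynomial ring in finitely many variables\<close>

text \<open>
  A polynomial maps exponents (finitely supported functions from variable indices to naturals)
  to coefficients. The variables \<open>t\<^sub>1, \<dots>, t\<^sub>s\<close> are indexed by \<open>0, \<dots>, s - 1\<close>, in line with the
  indexing of vectors and matrices.
\<close>

type_synonym 'k mpoly = "(nat \<Rightarrow>\<^sub>0 nat) \<Rightarrow>\<^sub>0 'k"

definition poly_ring :: "nat \<Rightarrow> 'k::field mpoly ring" where
  "poly_ring s =
    \<lparr>carrier = {p. \<forall>m \<in> Poly_Mapping.keys p. Poly_Mapping.keys m \<subseteq> {..<s}},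
     mult = (*), one = 1, zero = 0, add = (+)\<rparr>"

definition mvar :: "nat \<Rightarrow> 'k::field mpoly" where
  "mvar j = Poly_Mapping.single (Poly_Mapping.single j 1) 1"

definition mpower :: "nat \<Rightarrow> (nat \<Rightarrow> nat) \<Rightarrow> 'k::field mpoly" where
  "mpower s c = (\<Prod>j<s. mvar j ^ c j)"

definition mconst :: "'k::field \<Rightarrow> 'k mpoly" where
  "mconst c = Poly_Mapping.single 0 c"

definition total_deg_le :: "nat \<Rightarrow> 'k::field mpoly \<Rightarrow> bool" where
  "total_deg_le d p \<longleftrightarrow>
    (\<forall>m \<in> Poly_Mapping.keys p. (\<Sum>j \<in> Poly_Mapping.keys m. Poly_Mapping.lookup m j) \<le> d)"


section \<open>Lattices and lattice ideals\<close>

text \<open>A lattice in \<open>\<int>\<^sup>s\<close> is a subgroup of \<^term>\<open>monoid_vec TYPE(int) s\<close>.\<close>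

definition is_Z_basis :: "nat \<Rightarrow> int vec set \<Rightarrow> int vec list \<Rightarrow> bool" where
  "is_Z_basis s L \<alpha> \<longleftrightarrow>
    set \<alpha> \<subseteq> L \<and> distinct \<alpha> \<and>
    \<not> LinearCombinations.module.lin_dep class_ring (module_vec TYPE(int) s) (set \<alpha>) \<and>
    LinearCombinations.module.span class_ring (module_vec TYPE(int) s) (set \<alpha>) = L"

definition lattice_ideal :: "nat \<Rightarrow> int vec set \<Rightarrow> 'k::field mpoly set" where
  "lattice_ideal s L =
    genideal (poly_ring s)
      {mpower s (\<lambda>j. nat (a $ j)) - mpower s (\<lambda>j. nat (- (a $ j))) | a. a \<in> L}"


section \<open>Krull dimension and degree\<close>

text \<open>
  Supremum of the lengths \<open>n\<close> of chains \<open>P\<^sub>0 \<subset> \<dots> \<subset> P\<^sub>n\<close> of prime ideals. The zero ring, which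
  has no prime ideals, gets the value \<open>0\<close>.
\<close>

definition krull_dim :: "('a, 'b) ring_scheme \<Rightarrow> enat" where
  "krull_dim R =
    Sup {enat n | n P. (\<forall>i\<le>n. primeideal (P i) R) \<and> (\<forall>i<n. P i \<subset> P (Suc i))}"

text \<open>
  The quotient of the module \<open>M\<close> by the submodule \<open>N\<close>. On a coset \<open>X = N + x\<close> the union in the
  scalar multiplication is the single coset \<open>N + c x\<close>; a pointwise product \<open>{c y | y \<in> X}\<close> would
  not be a coset when \<open>c = 0\<close>.
\<close>

definition quotient_module :: "('r, 'a, 'm) module_scheme \<Rightarrow> 'a set \<Rightarrow> ('r, 'a set) module" where
  "quotient_module M N =
    \<lparr>carrier = a_rcosets\<^bsub>M\<^esub> N, mult = undefined, one = undefined,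
     zero = N, add = set_add M,
     smult = (\<lambda>c X. \<Union>x\<in>X. N +>\<^bsub>M\<^esub> (c \<odot>\<^bsub>M\<^esub> x))\<rparr>"

definition poly_space_le :: "nat \<Rightarrow> nat \<Rightarrow> ('k::field, 'k mpoly) module" where
  "poly_space_le s d =
    \<lparr>carrier = {p \<in> carrier (poly_ring s). total_deg_le d p}, mult = undefined, one = undefined,
     zero = 0, add = (+), smult = (\<lambda>c p. mconst c * p)\<rparr>"

definition affine_hilbert :: "nat \<Rightarrow> 'k::field mpoly set \<Rightarrow> nat \<Rightarrow> nat" where
  "affine_hilbert s I d =
    vectorspace.dim (class_ring :: 'k ring)
      (quotient_module (poly_space_le s d) {p \<in> I. total_deg_le d p})"

definition quotient_degree :: "nat \<Rightarrow> 'k::field mpoly set \<Rightarrow> real" where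
  "quotient_degree s I =
    (let k = the_enat (krull_dim (poly_ring s Quot I))
     in fact k * lim (\<lambda>i. real (affine_hilbert s I i) / real i ^ k))"

end

theory Submission
  imports Defs
begin

text \<open>
  Modulo \<open>I(L)\<close> the monomials \<open>t\<^sup>a\<close> fall into the classes of \<open>\<nat>\<^sup>s\<close> modulo \<open>L\<close>, and monomials of minimal
  degree in their classes form a basis of \<open>S / I(L)\<close> compatible with the degree filtration. The affine
  Hilbert function at \<open>d\<close> is therefore the number of points of \<open>\<int>\<^sup>s / L\<close> hit by the simplex of
  \<open>a \<in> \<nat>\<^sup>s\<close> with \<open>\<bar>a\<bar> \<le> d\<close>. The signed minors define a linear form \<open>\<phi>\<close> that vanishes on \<open>L\<close>. Let \<open>u\<close> be the
  difference of the vertices of the unit simplex where \<open>\<phi>\<close> is maximal and minimal. Then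
  \<open>\<int>\<^sup>s / (L + \<int> u)\<close> has order \<open>det [B | u]\<close>, which up to sign is \<open>\<phi> u\<close>, that is, the claimed degree, and
  each of its elements accounts for \<open>d + O(1)\<close> of the points. Linear growth of the Hilbert function
  bounds the Krull dimension by 1, because a chain of three primes yields two algebraically
  independent elements modulo the smallest prime; \<open>\<phi>\<close> provides a chain of two primes.
\<close>

section \<open>Residue systems modulo a nonsingular integer matrix\<close>

text \<open>The form \<phi> need not separate the points of \<int>^s / L, because this group may
  have torsion; this is why a finite quotient by L + \<int> u is used and its order computed. Write
  D for the claimed degree. On the simplex of size d the form takes values in an interval of length
  D d, and adding u raises it by exactly D, so a class modulo L + \<int> u contributes at most d + 1
  points modulo L. For the converse, u = p - q with vertices p and q, and a residue r of bounded
  size yields the points r + k p + (N - k) q, which differ by multiples of u. Such a point stays in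
  the simplex only if r has no negative entries, so residue systems carry this condition from the
  start. Since the ideal is not homogeneous, degrees at most d are counted rather than degree d, the
  origin is a vertex of the simplex, and the value 0 enters the maximum and the minimum.\<close>

definition residue_system :: "nat \<Rightarrow> int mat \<Rightarrow> int vec set \<Rightarrow> bool" where
  "residue_system n A R \<longleftrightarrow> finite R \<and> R \<subseteq> carrier_vec n \<and> (\<forall>r\<in>R. \<forall>i<n. 0 \<le> r $ i) \<and>
    (\<forall>x\<in>carrier_vec n. \<exists>!r. r \<in> R \<and> (\<exists>z\<in>carrier_vec n. x = r + A *\<^sub>v z))"

text \<open>A right inverse of \<open>U\<close> makes \<open>U\<close> surjective on integer
  vectors, so \<open>A * U\<close> and \<open>A\<close> have the same column lattice.\<close>

lemma residue_system_mult_invertible: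
  assumes A: "A \<in> carrier_mat n n" and U: "U \<in> carrier_mat n n" and V: "V \<in> carrier_mat n n"
    and UV: "U * V = 1\<^sub>m n" and R: "residue_system n (A * U) R"
  shows "residue_system n A R"
proof -
  have "(\<exists>z\<in>carrier_vec n. x = r + (A * U) *\<^sub>v z) \<longleftrightarrow> (\<exists>z\<in>carrier_vec n. x = r + A *\<^sub>v z)" for x r
  proof
    assume "\<exists>z\<in>carrier_vec n. x = r + (A * U) *\<^sub>v z"
    then obtain z where "z \<in> carrier_vec n" "x = r + (A * U) *\<^sub>v z" by auto
    then show "\<exists>z\<in>carrier_vec n. x = r + A *\<^sub>v z"
      using A U by (intro bexI[of _ "U *\<^sub>v z"]) auto
  next
    assume "\<exists>z\<in>carrier_vec n. x = r + A *\<^sub>v z"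
    then obtain z where z: "z \<in> carrier_vec n" "x = r + A *\<^sub>v z" by auto
    have "(A * U) *\<^sub>v (V *\<^sub>v z) = A *\<^sub>v (U *\<^sub>v (V *\<^sub>v z))"
      using A U V z by (intro assoc_mult_mat_vec) auto
    also have "U *\<^sub>v (V *\<^sub>v z) = z"
      using z U V UV by (metis assoc_mult_mat_vec one_mult_mat_vec)
    finally show "\<exists>z\<in>carrier_vec n. x = r + (A * U) *\<^sub>v z"
      using z V by (intro bexI[of _ "V *\<^sub>v z"]) auto
  qed
  with R show ?thesis unfolding residue_system_def by simp
qed

lemma residue_system_addcol:
  assumes A: "A \<in> carrier_mat n n" and kl: "k < n" "l < n" "k \<noteq> l"
    and R: "residue_system n (addcol a k l A) R"
  shows "residue_system n A R"
  using residue_system_mult_invertible[OF A, of "addrow_mat n a l k" "addrow_mat n (-a) l k"]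
    R addrow_mat_inv[of l n k a] addcol_mat[OF A, of l a k] kl by auto

lemma residue_system_swapcols:
  assumes A: "A \<in> carrier_mat n n" and kl: "k < n" "l < n"
    and R: "residue_system n (swapcols k l A) R"
  shows "residue_system n A R"
  using residue_system_mult_invertible[OF A, of "swaprows_mat n k l" "swaprows_mat n k l"]
    R swaprows_mat_inv[of k n l] swapcols_mat[OF A, of k l] kl by auto

lemma mult_vCons_first_row_zero:
  fixes A :: "int mat"
  assumes A: "A \<in> carrier_mat (Suc m) (Suc m)" and row0: "\<forall>j. 0 < j \<longrightarrow> j < Suc m \<longrightarrow> A $$ (0, j) = 0"
    and z: "z \<in> carrier_vec m"
  shows "A *\<^sub>v vCons a z =
    vCons (A $$ (0, 0) * a) (a \<cdot>\<^sub>v vec m (\<lambda>i. A $$ (Suc i, 0)) + mat_delete A 0 0 *\<^sub>v z)"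
proof -
  have "row A 0 = vCons (A $$ (0, 0)) (0\<^sub>v m)"
    using A row0 by (intro eq_vecI) (auto simp: vec_index_vCons)
  moreover have "row A (Suc i) = vCons (A $$ (Suc i, 0)) (row (mat_delete A 0 0) i)" if "i < m" for i
    using A that by (intro eq_vecI) (auto simp: vec_index_vCons mat_delete_def)
  ultimately show ?thesis
    using A z by (intro eq_vecI) (auto simp: vec_index_vCons less_Suc_eq_0_disj mult.commute mat_delete_def)
qed

text \<open>Division with remainder by the corner entry fixes the first coordinate of the residue
  and the multiple b of the first column. Subtracting b times the rest of that column leaves the
  residue problem of the minor. The number of residues thus multiplies exactly as the determinant
  does.\<close>

lemma residue_system_first_row_zero:
  assumes A: "A \<in> carrier_mat (Suc m) (Suc m)"
    and row0: "\<forall>j. 0 < j \<longrightarrow> j < Suc m \<longrightarrow> A $$ (0, j) = 0"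
    and g: "A $$ (0, 0) \<noteq> 0" and R: "residue_system m (mat_delete A 0 0) R"
  shows "residue_system (Suc m) A ((\<lambda>(a, r). vCons a r) ` ({0..<\<bar>A $$ (0, 0)\<bar>} \<times> R))"
    (is "residue_system _ _ ?S")
proof -
  let ?g = "A $$ (0, 0)" and ?c = "vec m (\<lambda>i. A $$ (Suc i, 0))" and ?A = "mat_delete A 0 0"
  have A': "?A \<in> carrier_mat m m" using mat_delete_carrier[OF A] by simp
  have Rc: "R \<subseteq> carrier_vec m" and fin: "finite R" and nn: "\<And>r i. r \<in> R \<Longrightarrow> i < m \<Longrightarrow> 0 \<le> r $ i"
    using R by (auto simp: residue_system_def)
  have ex1: "\<exists>!r. r \<in> R \<and> (\<exists>z\<in>carrier_vec m. x = r + ?A *\<^sub>v z)" if "x \<in> carrier_vec m" for x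
    using R that by (auto simp: residue_system_def)
  have rel: "vCons x0 x = vCons a r + A *\<^sub>v vCons b z \<longleftrightarrow>
      x0 = a + ?g * b \<and> x - b \<cdot>\<^sub>v ?c = r + ?A *\<^sub>v z"
    if "x \<in> carrier_vec m" "r \<in> carrier_vec m" "z \<in> carrier_vec m" for x0 x a r b z
  proof -
    have "vCons a r + A *\<^sub>v vCons b z = vCons (a + ?g * b) (r + (b \<cdot>\<^sub>v ?c + ?A *\<^sub>v z))"
      unfolding mult_vCons_first_row_zero[OF A row0 that(3)] using that A'
      by (intro eq_vecI) (auto simp: vec_index_vCons)
    moreover have "x = r + (b \<cdot>\<^sub>v ?c + w) \<longleftrightarrow> x - b \<cdot>\<^sub>v ?c = r + w" if "w \<in> carrier_vec m" for w
      using that \<open>x \<in> carrier_vec m\<close> \<open>r \<in> carrier_vec m\<close>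
      by (auto simp: vec_eq_iff algebra_simps)
    moreover have "?A *\<^sub>v z \<in> carrier_vec m" using A' that by simp
    ultimately show ?thesis by simp
  qed
  have "\<exists>!y. y \<in> ?S \<and> (\<exists>z\<in>carrier_vec (Suc m). x = y + A *\<^sub>v z)"
    if xc: "x \<in> carrier_vec (Suc m)" for x
  proof -
    obtain x0 x' where x: "x = vCons x0 x'" "x' \<in> carrier_vec m"
      using xc by (cases x) (auto dest: carrier_vecD)
    \<comment> \<open>The corner entry may be negative: the remainder is taken modulo its absolute
      value, while the exact division is by the entry itself.\<close>
    define b where "b = (x0 - x0 mod \<bar>?g\<bar>) div ?g"
    have "?g dvd x0 - x0 mod \<bar>?g\<bar>" by (metis abs_dvd_iff dvd_minus_mod)
    then have b: "x0 = x0 mod \<bar>?g\<bar> + ?g * b" by (simp add: b_def)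
    have bu: "a = x0 mod \<bar>?g\<bar> \<and> b' = b" if "a \<in> {0..<\<bar>?g\<bar>}" "x0 = a + ?g * b'" for a b'
    proof -
      have "x0 mod \<bar>?g\<bar> = a mod \<bar>?g\<bar>"
        unfolding that(2) by (metis abs_dvd_iff dvd_triv_left mod_eq_dvd_iff add_diff_cancel_left')
      then have "a = x0 mod \<bar>?g\<bar>" using that(1) by simp
      then show ?thesis using that(2) b g by auto
    qed
    obtain r z where rz: "r \<in> R" "z \<in> carrier_vec m" "x' - b \<cdot>\<^sub>v ?c = r + ?A *\<^sub>v z"
      using ex1[of "x' - b \<cdot>\<^sub>v ?c"] x by auto
    show ?thesis
    proof (rule ex1I)
      have "x = vCons (x0 mod \<bar>?g\<bar>) r + A *\<^sub>v vCons b z"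
        unfolding x(1) using rz Rc b x(2) by (subst rel) auto
      then show "vCons (x0 mod \<bar>?g\<bar>) r \<in> ?S \<and>
          (\<exists>z\<in>carrier_vec (Suc m). x = vCons (x0 mod \<bar>?g\<bar>) r + A *\<^sub>v z)"
        using rz g by (auto intro!: bexI[of _ "vCons b z"] image_eqI[of _ _ "(x0 mod \<bar>?g\<bar>, r)"])
    next
      fix y assume "y \<in> ?S \<and> (\<exists>z\<in>carrier_vec (Suc m). x = y + A *\<^sub>v z)"
      then obtain a r' w where y: "y = vCons a r'" "a \<in> {0..<\<bar>?g\<bar>}" "r' \<in> R"
        and w: "w \<in> carrier_vec (Suc m)" "x = y + A *\<^sub>v w" by auto
      obtain b' z' where w': "w = vCons b' z'" "z' \<in> carrier_vec m" using w(1) by (cases w) (auto dest: carrier_vecD)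
      have *: "x0 = a + ?g * b'" "x' - b' \<cdot>\<^sub>v ?c = r' + ?A *\<^sub>v z'"
        using w(2) unfolding x(1) y(1) w' using y(3) Rc w'(2) x(2) by (subst (asm) rel; auto)+
      from bu[OF y(2) *(1)] have "a = x0 mod \<bar>?g\<bar>" "b' = b" by auto
      moreover have "\<exists>!r. r \<in> R \<and> (\<exists>z\<in>carrier_vec m. x' - b \<cdot>\<^sub>v ?c = r + ?A *\<^sub>v z)"
        using ex1[of "x' - b \<cdot>\<^sub>v ?c"] x(2) by simp
      then have "r' = r" using rz *(2) y(3) w'(2) \<open>b' = b\<close> by (metis (no_types, lifting))
      ultimately show "y = vCons (x0 mod \<bar>?g\<bar>) r" using y by simp
    qed
  qed
  moreover have "\<forall>r\<in>?S. \<forall>i<Suc m. 0 \<le> r $ i"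
    using nn by (auto simp: vec_index_vCons)
  ultimately show ?thesis using fin Rc unfolding residue_system_def by auto
qed

text \<open>Column operations preserve the column lattice and the absolute value of the determinant.
  The Euclidean algorithm on the first row, measured by the sum of the absolute values of its
  entries, leaves a single nonzero entry; moved to the corner, it makes the matrix block triangular
  and the minor falls under induction.\<close>

lemma residue_system_exists:
  assumes "A \<in> carrier_mat n n" "det A \<noteq> 0"
  shows "\<exists>R. residue_system n A R \<and> int (card R) = \<bar>det A\<bar>"
  using assms
proof (induction n arbitrary: A)
  case 0
  have "x = 0\<^sub>v 0" if "x \<in> carrier_vec 0" for x :: "int vec" using that by (auto simp: vec_eq_iff)
  moreover have "0\<^sub>v 0 = 0\<^sub>v 0 + A *\<^sub>v 0\<^sub>v 0" using 0 by (intro eq_vecI) auto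
  ultimately have "residue_system 0 A {0\<^sub>v 0}"
    unfolding residue_system_def by (metis (no_types, lifting) finite.simps insert_subset
      empty_subsetI not_less_zero singletonD singletonI zero_carrier_vec)
  moreover have "det A = 1" using 0 by simp
  ultimately show ?case by (intro exI[of _ "{0\<^sub>v 0}"]) auto
next
  case (Suc m)
  let ?n = "Suc m"
  from Suc.prems show ?case
  proof (induction "nat (\<Sum>j<?n. \<bar>A $$ (0, j)\<bar>)" arbitrary: A rule: less_induct)
    case less
    note A = less.prems(1)
    show ?case
    proof (cases "\<exists>k l. k < ?n \<and> l < ?n \<and> k \<noteq> l \<and> A $$ (0, l) \<noteq> 0 \<and> \<bar>A $$ (0, l)\<bar> \<le> \<bar>A $$ (0, k)\<bar>")
      case True
      then obtain k l where kl: "k < ?n" "l < ?n" "k \<noteq> l" "A $$ (0, l) \<noteq> 0" "\<bar>A $$ (0, l)\<bar> \<le> \<bar>A $$ (0, k)\<bar>"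
        by auto
      \<comment> \<open>The sign makes the smaller entry cancel against the larger one, whose
        absolute value drops by that of the smaller, nonzero entry.\<close>
      define a where "a = - sgn (A $$ (0, k)) * sgn (A $$ (0, l))"
      let ?A = "addcol a k l A"
      have lt: "\<bar>?A $$ (0, k)\<bar> < \<bar>A $$ (0, k)\<bar>"
        using A kl by (auto simp: a_def sgn_if split: if_splits)
      have "(\<Sum>j<?n. \<bar>?A $$ (0, j)\<bar>) < (\<Sum>j<?n. \<bar>A $$ (0, j)\<bar>)"
      proof (rule sum_strict_mono_ex1)
        show "\<forall>j\<in>{..<?n}. \<bar>?A $$ (0, j)\<bar> \<le> \<bar>A $$ (0, j)\<bar>"
          using A lt by (metis carrier_matD(1,2) index_mat_addcol(1) lessThan_iff less_imp_le order_refl zero_less_Suc)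
      qed (use lt kl in auto)
      then have "nat (\<Sum>j<?n. \<bar>?A $$ (0, j)\<bar>) < nat (\<Sum>j<?n. \<bar>A $$ (0, j)\<bar>)"
        using sum_nonneg[of "{..<?n}" "\<lambda>j. \<bar>?A $$ (0, j)\<bar>"] by (subst nat_mono_iff) linarith+
      moreover have "det ?A = det A" by (rule det_addcol[OF kl(2,3) A])
      moreover have "?A \<in> carrier_mat ?n ?n" using A by auto
      ultimately obtain R where "residue_system ?n ?A R" "int (card R) = \<bar>det ?A\<bar>"
        using less.hyps[of ?A] less.prems by auto
      then show ?thesis using residue_system_addcol[OF A kl(1-3)] \<open>det ?A = det A\<close> by auto
    next
      case False
      have "\<exists>k<?n. A $$ (0, k) \<noteq> 0"
      proof (rule ccontr)
        assume "\<not> ?thesis"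
        then have "det A = 0" by (subst laplace_expansion_row[OF A, of 0]) auto
        then show False using less.prems by simp
      qed
      \<comment> \<open>Of two nonzero entries, one is at most as large as the other in absolute
        value, so a further reduction would be possible. Hence \<open>k\<close> is the only nonzero
        position.\<close>
      then obtain k where k: "k < ?n" "A $$ (0, k) \<noteq> 0" by auto
      have zero: "A $$ (0, j) = 0" if "j < ?n" "j \<noteq> k" for j
        using False k that by (metis linorder_le_cases)
      define C where "C = swapcols 0 k A"
      have C: "C \<in> carrier_mat ?n ?n" using A by (simp add: C_def)
      have detC: "\<bar>det C\<bar> = \<bar>det A\<bar>"
      proof (cases "k = 0")
        case True
        then have "C = A" using A by (intro eq_matI) (auto simp: C_def)
        then show ?thesis by simp
      next
        case False
        then show ?thesis using A k det_swapcols[of 0 ?n k A] by (simp add: C_def)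
      qed
      have C0: "C $$ (0, 0) \<noteq> 0" using A k by (simp add: C_def)
      have Cz: "\<forall>j. 0 < j \<longrightarrow> j < ?n \<longrightarrow> C $$ (0, j) = 0" using A k zero by (auto simp: C_def)
      have "det C = (\<Sum>j<?n. C $$ (0, j) * cofactor C 0 j)"
        by (rule laplace_expansion_row[OF C]) simp
      also have "\<dots> = C $$ (0, 0) * det (mat_delete C 0 0)"
        unfolding lessThan_Suc_eq_insert_0 using Cz by (subst sum.insert) (auto simp: cofactor_def intro!: sum.neutral)
      finally have dC: "det C = C $$ (0, 0) * det (mat_delete C 0 0)" .
      moreover have "mat_delete C 0 0 \<in> carrier_mat m m" using mat_delete_carrier[OF C] by simp
      moreover have "det C \<noteq> 0" using detC less.prems by auto
      ultimately obtain R where R: "residue_system m (mat_delete C 0 0) R" "int (card R) = \<bar>det (mat_delete C 0 0)\<bar>"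
        using Suc.IH[of "mat_delete C 0 0"] by auto
      let ?S = "(\<lambda>(a, r). vCons a r) ` ({0..<\<bar>C $$ (0, 0)\<bar>} \<times> R)"
      have "residue_system ?n C ?S"
        by (rule residue_system_first_row_zero[OF C Cz C0 R(1)])
      then have "residue_system ?n A ?S"
        unfolding C_def using residue_system_swapcols[OF A] k by blast
      moreover have "card ?S = card ({0..<\<bar>C $$ (0, 0)\<bar>} \<times> R)"
        by (rule card_image) (auto simp: inj_on_def)
      then have "int (card ?S) = \<bar>det A\<bar>"
        using R(2) detC dC by (simp add: card_cartesian_product abs_mult)
      ultimately show ?thesis by blast
    qed
  qed
qed

section \<open>Counting points of a simplex modulo a lattice\<close>

text \<open>\<open>submatrix\<close> enumerates the remaining rows by \<open>pick\<close>, whereas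
  \<open>mat_delete\<close> shifts indices explicitly. This closed form turns the minors of the
  theorem into cofactors.\<close>

lemma pick_Compl_singleton: "pick (- {i}) a = (if a < i then a else Suc a)"
proof (induction a)
  case 0
  have "(LEAST a::nat. a \<noteq> 0) = 1" by (rule Least_equality) auto
  then show ?case by (auto intro: Least_equality)
next
  case (Suc a)
  have "(LEAST b. b \<in> - {i} \<and> (if a < i then a else Suc a) < b) = (if Suc a < i then Suc a else Suc (Suc a))"
    by (rule Least_equality) (auto split: if_splits)
  then show ?case by (simp add: Suc)
qed

section \<open>Bordered matrices and the linear form given by the signed minors\<close>

definition adjoin_col :: "int mat \<Rightarrow> int vec \<Rightarrow> int mat" where
  "adjoin_col B x = mat (dim_row B) (Suc (dim_col B)) (\<lambda>(i, j). if j < dim_col B then B $$ (i, j) else x $ i)"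

lemma adjoin_col_carrier [simp]: "B \<in> carrier_mat n m \<Longrightarrow> adjoin_col B x \<in> carrier_mat n (Suc m)"
  by (auto simp: adjoin_col_def)

lemma adjoin_col_mult_vec:
  assumes B: "B \<in> carrier_mat n m" and x: "x \<in> carrier_vec n" and y: "y \<in> carrier_vec m"
    and z: "z \<in> carrier_vec (Suc m)" "\<And>i. i < m \<Longrightarrow> z $ i = y $ i"
  shows "adjoin_col B x *\<^sub>v z = B *\<^sub>v y + z $ m \<cdot>\<^sub>v x"
  using assms by (intro eq_vecI) (auto simp: adjoin_col_def scalar_prod_def)

lemma mat_delete_adjoin_col:
  assumes B: "B \<in> carrier_mat (Suc m) m" and i: "i < Suc m"
  shows "mat_delete (adjoin_col B x) i m = submatrix B (- {i}) UNIV"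
proof -
  have "{a. a < Suc m \<and> a \<in> - {i}} = {..<Suc m} - {i}" by auto
  then have "card {a. a < Suc m \<and> a \<in> - {i}} = m" using i by simp
  then show ?thesis using B i
    by (intro eq_matI)
      (auto simp: mat_delete_def adjoin_col_def dim_submatrix submatrix_index pick_UNIV pick_Compl_singleton)
qed

text \<open>Writing the ambient dimension as \<open>Suc m\<close> makes \<open>B\<close> with one
  more column a square matrix. The condition \<open>inj\<close> is the independence of the columns.
  The minors are numbered from 1 and the coordinates from 0, so coordinate j belongs to
  \<open>v (Suc j)\<close>.\<close>

locale corank_one_lattice =
  fixes m :: nat and B :: "int mat" and v :: "nat \<Rightarrow> int"
  assumes B: "B \<in> carrier_mat (Suc m) m"
    and inj: "\<And>y. y \<in> carrier_vec m \<Longrightarrow> B *\<^sub>v y = 0\<^sub>v (Suc m) \<Longrightarrow> y = 0\<^sub>v m"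
    and v: "\<And>i. i \<in> {1..Suc m} \<Longrightarrow> v i = (-1) ^ i * det (submatrix B (- {i - 1}) UNIV)"
begin

definition L :: "int vec set" where
  "L = {B *\<^sub>v y | y. y \<in> carrier_vec m}"

definition \<phi> :: "int vec \<Rightarrow> int" where
  "\<phi> x = (\<Sum>j<Suc m. v (Suc j) * x $ j)"

text \<open>This is Laplace expansion along the adjoined column. In row i the cofactor has the sign
  (-1)^(i + m) and \<open>v (Suc i)\<close> has the sign (-1)^(i + 1), so the two differ by a factor
  that does not depend on i.\<close>

lemma \<phi>_eq_det:
  assumes x: "x \<in> carrier_vec (Suc m)"
  shows "\<phi> x = (-1) ^ Suc m * det (adjoin_col B x)"
proof -
  have A: "adjoin_col B x \<in> carrier_mat (Suc m) (Suc m)" using B by simp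
  have "det (adjoin_col B x) = (\<Sum>i<Suc m. adjoin_col B x $$ (i, m) * cofactor (adjoin_col B x) i m)"
    by (rule laplace_expansion_column[OF A]) simp
  also have "\<dots> = (\<Sum>i<Suc m. (-1) ^ Suc m * (v (Suc i) * x $ i))"
  proof (rule sum.cong[OF refl])
    fix i assume i: "i \<in> {..<Suc m}"
    then have "adjoin_col B x $$ (i, m) = x $ i" using B by (simp add: adjoin_col_def)
    moreover have "cofactor (adjoin_col B x) i m = (-1) ^ Suc m * v (Suc i)"
      using i v[of "Suc i"] by (simp add: cofactor_def mat_delete_adjoin_col[OF B] power_add)
    ultimately show "adjoin_col B x $$ (i, m) * cofactor (adjoin_col B x) i m = (-1) ^ Suc m * (v (Suc i) * x $ i)"
      by (simp add: ac_simps)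
  qed
  finally show ?thesis unfolding \<phi>_def sum_distrib_left[symmetric]
    by (simp add: mult.assoc[symmetric] flip: power_mult_distrib)
qed

lemma \<phi>_add: "x \<in> carrier_vec (Suc m) \<Longrightarrow> y \<in> carrier_vec (Suc m) \<Longrightarrow> \<phi> (x + y) = \<phi> x + \<phi> y"
  by (auto simp: \<phi>_def distrib_left sum.distrib)

lemma \<phi>_diff: "x \<in> carrier_vec (Suc m) \<Longrightarrow> y \<in> carrier_vec (Suc m) \<Longrightarrow> \<phi> (x - y) = \<phi> x - \<phi> y"
  by (auto simp: \<phi>_def right_diff_distrib sum_subtractf)

lemma \<phi>_smult: "x \<in> carrier_vec (Suc m) \<Longrightarrow> \<phi> (c \<cdot>\<^sub>v x) = c * \<phi> x"
  by (auto simp: \<phi>_def sum_distrib_left ac_simps simp del: sum.lessThan_Suc)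

lemma L_carrier: "x \<in> L \<Longrightarrow> x \<in> carrier_vec (Suc m)"
  using B by (auto simp: L_def)

lemma L_zero: "0\<^sub>v (Suc m) \<in> L"
  unfolding L_def using B by (intro CollectI exI[of _ "0\<^sub>v m"]) auto

lemma L_diff:
  assumes "x \<in> L" "y \<in> L"
  shows "x - y \<in> L"
proof -
  obtain a b where "a \<in> carrier_vec m" "x = B *\<^sub>v a" "b \<in> carrier_vec m" "y = B *\<^sub>v b"
    using assms by (auto simp: L_def)
  then show ?thesis unfolding L_def
    by (intro CollectI exI[of _ "a - b"]) (simp add: mult_minus_distrib_mat_vec[OF B])
qed

text \<open>If x is a combination of the columns of \<open>B\<close>, its coefficients followed by
  -1 form a nonzero kernel vector of the matrix bordered by x.\<close>

lemma \<phi>_L: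
  assumes "x \<in> L"
  shows "\<phi> x = 0"
proof -
  obtain y where y: "y \<in> carrier_vec m" "x = B *\<^sub>v y" using assms by (auto simp: L_def)
  define z where "z = vec (Suc m) (\<lambda>i. if i < m then y $ i else -1)"
  have z: "z \<in> carrier_vec (Suc m)" by (simp add: z_def)
  have x: "x \<in> carrier_vec (Suc m)" using L_carrier assms .
  have "adjoin_col B x *\<^sub>v z = B *\<^sub>v y + z $ m \<cdot>\<^sub>v x"
    by (rule adjoin_col_mult_vec[OF B x y(1) z]) (simp add: z_def)
  also have "\<dots> = 0\<^sub>v (Suc m)" using x y B by (intro eq_vecI) (auto simp: z_def)
  finally have "adjoin_col B x *\<^sub>v z = 0\<^sub>v (Suc m)" .
  moreover have "z \<noteq> 0\<^sub>v (Suc m)" by (auto simp: z_def vec_eq_iff intro!: exI[of _ m])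
  ultimately have "det (adjoin_col B x) = 0"
    using det_0_iff_vec_prod_zero[of "adjoin_col B x" "Suc m"] B z by auto
  then show ?thesis by (simp add: \<phi>_eq_det[OF x])
qed

lemma \<phi>_unit_vec: "j < Suc m \<Longrightarrow> \<phi> (unit_vec (Suc m) j) = v (Suc j)"
proof -
  assume j: "j < Suc m"
  have "\<phi> (unit_vec (Suc m) j) = (\<Sum>i<Suc m. if i = j then v (Suc j) else 0)"
    unfolding \<phi>_def by (rule sum.cong) (auto simp: unit_vec_def)
  then show ?thesis using j by (simp del: sum.lessThan_Suc)
qed

text \<open>If all maximal minors vanished, then every unit vector would be torsion modulo the column space
  of \<^term>\<open>B\<close>, and a nonsingular diagonal matrix would factor through a matrix with a zero column.\<close>

lemma minors_not_all_zero: "\<exists>j<Suc m. v (Suc j) \<noteq> 0"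
proof (rule ccontr)
  let ?n = "Suc m"
  assume "\<not> ?thesis"
  then have v0: "\<And>j. j < ?n \<Longrightarrow> v (Suc j) = 0" by auto
  have "\<exists>y c. y \<in> carrier_vec m \<and> c \<noteq> 0 \<and> B *\<^sub>v y = c \<cdot>\<^sub>v unit_vec ?n j" if j: "j < ?n" for j
  proof -
    let ?e = "unit_vec ?n j :: int vec"
    have "det (adjoin_col B ?e) = 0"
      using \<phi>_eq_det[of ?e] \<phi>_unit_vec[OF j] v0[OF j] by simp
    then obtain z where z: "z \<in> carrier_vec ?n" "z \<noteq> 0\<^sub>v ?n" "adjoin_col B ?e *\<^sub>v z = 0\<^sub>v ?n"
      using det_0_iff_vec_prod_zero[of "adjoin_col B ?e" ?n] B by auto
    define y where "y = vec m (\<lambda>i. z $ i)"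
    have y: "y \<in> carrier_vec m" by (simp add: y_def)
    have eq: "B *\<^sub>v y + z $ m \<cdot>\<^sub>v ?e = 0\<^sub>v ?n"
      using adjoin_col_mult_vec[OF B _ y z(1), of ?e] z(3) by (simp add: y_def)
    have By: "B *\<^sub>v y \<in> carrier_vec ?n" using B y by simp
    \<comment> \<open>A kernel vector with last entry 0 would be a nontrivial relation among the
      columns of \<open>B\<close>.\<close>
    have "z $ m \<noteq> 0"
    proof
      assume zm: "z $ m = 0"
      have "0 \<cdot>\<^sub>v ?e = 0\<^sub>v ?n" by (intro eq_vecI) auto
      then have "B *\<^sub>v y = 0\<^sub>v ?n" using eq By zm by simp
      then have "y = 0\<^sub>v m" using inj y by simp
      then have "z $ i = 0" if "i < m" for i using that by (metis y_def index_vec index_zero_vec(1))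
      then have "z = 0\<^sub>v ?n" using z(1) zm by (intro eq_vecI) (auto simp: less_Suc_eq)
      then show False using z(2) by simp
    qed
    moreover have "B *\<^sub>v y = (- z $ m) \<cdot>\<^sub>v ?e"
    proof (rule eq_vecI)
      fix i assume "i < dim_vec ((- z $ m) \<cdot>\<^sub>v ?e)"
      moreover from eq have "(B *\<^sub>v y + z $ m \<cdot>\<^sub>v ?e) $ i = 0\<^sub>v ?n $ i" by simp
      ultimately show "(B *\<^sub>v y) $ i = ((- z $ m) \<cdot>\<^sub>v ?e) $ i" using B by auto
    qed (use B in auto)
    ultimately show ?thesis using y by (intro exI[of _ y] exI[of _ "- z $ m"]) auto
  qed
  then obtain y c where yc: "\<And>j. j < ?n \<Longrightarrow> y j \<in> carrier_vec m" "\<And>j. j < ?n \<Longrightarrow> c j \<noteq> 0"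
    "\<And>j. j < ?n \<Longrightarrow> B *\<^sub>v y j = c j \<cdot>\<^sub>v unit_vec ?n j" by metis
  define P where "P = adjoin_col B (0\<^sub>v ?n)"
  define Q where "Q = mat ?n ?n (\<lambda>(i, j). if i < m then y j $ i else 0)"
  have P: "P \<in> carrier_mat ?n ?n" using B by (simp add: P_def)
  have Q: "Q \<in> carrier_mat ?n ?n" by (simp add: Q_def)
  have "P *\<^sub>v unit_vec ?n m = B *\<^sub>v 0\<^sub>v m + unit_vec ?n m $ m \<cdot>\<^sub>v 0\<^sub>v ?n"
    unfolding P_def by (rule adjoin_col_mult_vec[OF B]) auto
  also have "\<dots> = 0\<^sub>v ?n" using B by (intro eq_vecI) auto
  finally have "det P = 0"
    using det_0_iff_vec_prod_zero[OF P] unit_vec_nonzero[of m ?n]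
    by (metis lessI unit_vec_carrier)
  then have "det (P * Q) = 0" using det_mult[OF P Q] by simp
  moreover have col: "(P * Q) $$ (i, j) = (if i = j then c j else 0)" if "i < ?n" "j < ?n" for i j
  proof -
    have "col (P * Q) j = P *\<^sub>v col Q j" by (rule col_mult2[OF P Q that(2)])
    also have "\<dots> = B *\<^sub>v y j + col Q j $ m \<cdot>\<^sub>v 0\<^sub>v ?n"
      unfolding P_def by (rule adjoin_col_mult_vec[OF B]) (use yc(1) that in \<open>auto simp: Q_def\<close>)
    also have "\<dots> = c j \<cdot>\<^sub>v unit_vec ?n j" using yc(3)[OF that(2)] B by (intro eq_vecI) auto
    finally have "col (P * Q) j $ i = (c j \<cdot>\<^sub>v unit_vec ?n j) $ i" by simp
    then show ?thesis using that P Q by (auto simp: unit_vec_def)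
  qed
  have PQ: "P * Q \<in> carrier_mat ?n ?n" using P Q by simp
  have "det (P * Q) = prod_list (diag_mat (P * Q))"
    by (rule det_upper_triangular[OF _ PQ]) (use PQ col in \<open>auto simp: upper_triangular_def\<close>)
  also have "\<dots> \<noteq> 0" using PQ col yc(2) P Q by (auto simp: diag_mat_def prod_list_zero_iff)
  ultimately show False by simp
qed

section \<open>Extreme values of the linear form on simplices\<close>

definition vmax :: int where "vmax = Max (insert 0 (v ` {1..Suc m}))"
definition vmin :: int where "vmin = Min (insert 0 (v ` {1..Suc m}))"

lemma vmax_bounds: "0 \<le> vmax" "j < Suc m \<Longrightarrow> v (Suc j) \<le> vmax"
  unfolding vmax_def by (rule Max_ge; force)+

lemma vmin_bounds: "vmin \<le> 0" "j < Suc m \<Longrightarrow> vmin \<le> v (Suc j)"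
  unfolding vmin_def by (rule Min_le; force)+

lemma vmin_less_vmax: "vmin < vmax"
  using minors_not_all_zero vmin_bounds vmax_bounds by (metis linorder_neqE_linordered_idom order.strict_trans1 order.strict_trans2)

definition simplex :: "nat \<Rightarrow> int vec set" where
  "simplex d = {x \<in> carrier_vec (Suc m). (\<forall>j<Suc m. 0 \<le> x $ j) \<and> (\<Sum>j<Suc m. x $ j) \<le> int d}"

text \<open>The coordinate sum is only bounded by d, so replacing it by d uses \<open>vmin\<close>
  \<le> 0 \<le> \<open>vmax\<close>, which holds because 0 is included in both sets.\<close>

lemma \<phi>_simplex_bounds:
  assumes "x \<in> simplex d"
  shows "vmin * int d \<le> \<phi> x" "\<phi> x \<le> vmax * int d"
proof -
  have nn: "\<And>j. j < Suc m \<Longrightarrow> 0 \<le> x $ j" and sm: "(\<Sum>j<Suc m. x $ j) \<le> int d"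
    using assms by (auto simp: simplex_def)
  have "vmin * int d \<le> vmin * (\<Sum>j<Suc m. x $ j)" using sm vmin_bounds by (simp add: mult_left_mono_neg)
  also have "\<dots> \<le> \<phi> x" unfolding \<phi>_def sum_distrib_left
    by (rule sum_mono) (use nn vmin_bounds in \<open>auto intro!: mult_right_mono\<close>)
  finally show "vmin * int d \<le> \<phi> x" .
  have "\<phi> x \<le> vmax * (\<Sum>j<Suc m. x $ j)" unfolding \<phi>_def sum_distrib_left
    by (rule sum_mono) (use nn vmax_bounds in \<open>auto intro!: mult_right_mono\<close>)
  also have "\<dots> \<le> vmax * int d" using sm vmax_bounds by (simp add: mult_left_mono)
  finally show "\<phi> x \<le> vmax * int d" .
qed

text \<open>The value 0 is taken at the origin, the others at the unit vectors.\<close>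

lemma extremal_vertex:
  assumes "w \<in> insert 0 (v ` {1..Suc m})"
  shows "\<exists>e\<in>simplex 1. \<phi> e = w"
proof (cases "w = 0")
  case True
  then show ?thesis by (intro bexI[of _ "0\<^sub>v (Suc m)"]) (auto simp: simplex_def \<phi>_def)
next
  case False
  then obtain i where "i \<in> {1..Suc m}" "w = v i" using assms by auto
  then obtain j where j: "j < Suc m" "w = v (Suc j)" by (metis atLeastAtMost_iff Suc_le_D One_nat_def Suc_le_mono less_Suc_eq_le)
  have "(\<Sum>i<Suc m. unit_vec (Suc m) j $ i) = (\<Sum>i<Suc m. if i = j then 1 else (0::int))"
    by (rule sum.cong) (auto simp: unit_vec_def)
  then have "unit_vec (Suc m) j \<in> simplex 1"
    using j(1) by (auto simp: simplex_def unit_vec_def simp del: sum.lessThan_Suc)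
  then show ?thesis using \<phi>_unit_vec[OF j(1)] j(2) by blast
qed


lemma card_arithmetic_progression_le:
  fixes D :: int
  assumes D: "0 < D"
  shows "finite {k. a \<le> c + k * D \<and> c + k * D \<le> a + int d * D}"
    "card {k. a \<le> c + k * D \<and> c + k * D \<le> a + int d * D} \<le> d + 1"
proof -
  \<comment> \<open>The least k with a \<le> c + k D, since \<open>div\<close> rounds down.\<close>
  let ?k = "- ((c - a) div D)"
  have "k \<in> {?k..?k + int d}" if "a \<le> c + k * D" "c + k * D \<le> a + int d * D" for k
  proof -
    have "((c - a) div D) * D \<le> c - a" "c - a < ((c - a) div D) * D + D"
      using D by (simp_all add: div_mult_mod_eq minus_mod_eq_div_mult[symmetric] pos_mod_bound)
    moreover define q where "q = (c - a) div D"
    ultimately have "- D < (k + q) * D" "(k + q) * D \<le> int d * D"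
      using that by (simp_all add: algebra_simps)
    then have "- 1 < k + q" "k + q \<le> int d"
      using D mult_less_cancel_right_pos[of D "-1" "k + q"] by auto
    then show ?thesis by (auto simp: q_def)
  qed
  then have sub: "{k. a \<le> c + k * D \<and> c + k * D \<le> a + int d * D} \<subseteq> {?k..?k + int d}" by blast
  then show "finite {k. a \<le> c + k * D \<and> c + k * D \<le> a + int d * D}"
    using finite_subset by blast
  show "card {k. a \<le> c + k * D \<and> c + k * D \<le> a + int d * D} \<le> d + 1"
    using card_mono[OF _ sub] by simp
qed

text \<open>A point x is written as a residue plus a lattice vector plus \<kappa> u, and the residue
  together with \<kappa> determines x modulo \<open>L\<close>. Counting these pairs gives the upper
  bound, exhibiting enough of them the lower one. The map \<open>q\<close> is left arbitrary so that
  a normal form of monomials can take its place; \<open>d0\<close> depends neither on it nor on d.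
  For small d the truncated subtraction makes the lower bound trivial.\<close>

lemma card_simplex_classes:
  "\<exists>d0. \<forall>d. \<forall>q :: int vec \<Rightarrow> 'b. (\<forall>x\<in>simplex d. \<forall>y\<in>simplex d. q x = q y \<longleftrightarrow> x - y \<in> L) \<longrightarrow>
    finite (q ` simplex d) \<and>
    nat (vmax - vmin) * (d + 1 - d0) \<le> card (q ` simplex d) \<and>
    card (q ` simplex d) \<le> nat (vmax - vmin) * (d + 1)"
proof -
  let ?n = "Suc m"
  define D where "D = vmax - vmin"
  have D: "D > 0" using vmin_less_vmax by (simp add: D_def)
  have "vmax \<in> insert 0 (v ` {1..?n})" "vmin \<in> insert 0 (v ` {1..?n})"
    unfolding vmax_def vmin_def by (rule Max_in Min_in; simp)+
  then obtain p q where pq: "p \<in> simplex 1" "\<phi> p = vmax" "q \<in> simplex 1" "\<phi> q = vmin"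
    using extremal_vertex by metis
  define u where "u = p - q"
  have pc: "p \<in> carrier_vec ?n" and qc: "q \<in> carrier_vec ?n" using pq by (auto simp: simplex_def)
  then have u: "u \<in> carrier_vec ?n" by (simp add: u_def)
  have \<phi>u: "\<phi> u = D" using pq pc qc by (simp add: u_def \<phi>_diff D_def)
  define A where "A = adjoin_col B u"
  have A: "A \<in> carrier_mat ?n ?n" using B by (simp add: A_def)
  have "\<bar>(-1) ^ Suc m * det A\<bar> = D" using \<phi>_eq_det[OF u] \<phi>u D by (simp add: A_def)
  then have "\<bar>det A\<bar> = D" by (simp only: abs_mult power_abs) simp
  then obtain R where R: "residue_system ?n A R" "int (card R) = D"
    using residue_system_exists[OF A] D by auto
  have finR: "finite R" and Rc: "R \<subseteq> carrier_vec ?n" and Rnn: "\<And>r i. r \<in> R \<Longrightarrow> i < ?n \<Longrightarrow> 0 \<le> r $ i"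
    and Rex: "\<And>x. x \<in> carrier_vec ?n \<Longrightarrow> \<exists>!r. r \<in> R \<and> (\<exists>z\<in>carrier_vec ?n. x = r + A *\<^sub>v z)"
    using R(1) by (auto simp: residue_system_def)
  have Az: "(\<exists>z\<in>carrier_vec ?n. x = r + A *\<^sub>v z) \<longleftrightarrow> (\<exists>k. \<exists>l\<in>L. x = r + (l + k \<cdot>\<^sub>v u))" for x r
  proof
    assume "\<exists>z\<in>carrier_vec ?n. x = r + A *\<^sub>v z"
    then obtain z where z: "z \<in> carrier_vec ?n" "x = r + A *\<^sub>v z" by auto
    have "A *\<^sub>v z = B *\<^sub>v vec m (\<lambda>i. z $ i) + z $ m \<cdot>\<^sub>v u"
      unfolding A_def by (rule adjoin_col_mult_vec[OF B u _ z(1)]) auto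
    then show "\<exists>k. \<exists>l\<in>L. x = r + (l + k \<cdot>\<^sub>v u)"
      using z(2) by (intro exI[of _ "z $ m"] bexI[of _ "B *\<^sub>v vec m (\<lambda>i. z $ i)"]) (auto simp: L_def)
  next
    assume "\<exists>k. \<exists>l\<in>L. x = r + (l + k \<cdot>\<^sub>v u)"
    then obtain k y where y: "y \<in> carrier_vec m" "x = r + (B *\<^sub>v y + k \<cdot>\<^sub>v u)" by (auto simp: L_def)
    define z where "z = vec ?n (\<lambda>i. if i < m then y $ i else k)"
    have "A *\<^sub>v z = B *\<^sub>v y + z $ m \<cdot>\<^sub>v u"
      unfolding A_def by (rule adjoin_col_mult_vec[OF B u y(1)]) (auto simp: z_def)
    then show "\<exists>z\<in>carrier_vec ?n. x = r + A *\<^sub>v z" using y(2) by (intro bexI[of _ z]) (auto simp: z_def)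
  qed
  have "\<forall>x\<in>carrier_vec ?n. \<exists>r k. r \<in> R \<and> (\<exists>l\<in>L. x = r + (l + k \<cdot>\<^sub>v u))"
    using Rex Az by metis
  then obtain \<rho> \<kappa> where rk: "\<And>x. x \<in> carrier_vec ?n \<Longrightarrow> \<rho> x \<in> R"
    "\<And>x. x \<in> carrier_vec ?n \<Longrightarrow> \<exists>l\<in>L. x = \<rho> x + (l + \<kappa> x \<cdot>\<^sub>v u)" by metis
  have uniq: "r = r'" if "r \<in> R" "r' \<in> R" "l \<in> L" "l' \<in> L" "r + (l + k \<cdot>\<^sub>v u) = r' + (l' + k' \<cdot>\<^sub>v u)" for r r' l l' k k'
  proof -
    have "r + (l + k \<cdot>\<^sub>v u) \<in> carrier_vec ?n" using that Rc L_carrier u by auto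
    with Rex[OF this] show ?thesis using that Az by metis
  qed
  \<comment> \<open>A common bound for the coordinate sums of all residues; the sum over all of
    \<open>R\<close> suffices because every entry is non-negative.\<close>
  define d0 where "d0 = nat (\<Sum>r\<in>R. \<Sum>j<?n. r $ j)"
  have d0: "(\<Sum>j<?n. r $ j) \<le> int d0" if "r \<in> R" for r
  proof -
    have "(\<Sum>j<?n. r $ j) \<le> (\<Sum>r\<in>R. \<Sum>j<?n. r $ j)"
      by (rule member_le_sum) (use that finR Rnn in \<open>auto intro!: sum_nonneg simp del: sum.lessThan_Suc\<close>)
    then show ?thesis unfolding d0_def by linarith
  qed
  have main: "finite (f ` simplex d) \<and> nat D * (d + 1 - d0) \<le> card (f ` simplex d) \<and> card (f ` simplex d) \<le> nat D * (d + 1)"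
    if f: "\<forall>x\<in>simplex d. \<forall>y\<in>simplex d. f x = f y \<longleftrightarrow> x - y \<in> L" for d and f :: "int vec \<Rightarrow> 'b"
  proof -
    \<comment> \<open>The multiples of u that \<phi> permits for residue r: the interval ends at
      \<open>vmax\<close> d, because \<open>vmin\<close> d + d D = \<open>vmax\<close> d.\<close>
    define K where "K r = {k. vmin * int d \<le> \<phi> r + k * D \<and> \<phi> r + k * D \<le> vmin * int d + int d * D}" for r
    have K: "finite (K r)" "card (K r) \<le> d + 1" for r
      unfolding K_def by (rule card_arithmetic_progression_le[OF D])+
    have sc: "x \<in> carrier_vec ?n" if "x \<in> simplex d" for x using that by (simp add: simplex_def)
    have in_S: "(\<rho> x, \<kappa> x) \<in> Sigma R K" if xs: "x \<in> simplex d" for x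
    proof -
      obtain l where l: "l \<in> L" "x = \<rho> x + (l + \<kappa> x \<cdot>\<^sub>v u)" using rk(2)[OF sc[OF xs]] by blast
      have "\<phi> x = \<phi> (\<rho> x + (l + \<kappa> x \<cdot>\<^sub>v u))" using l(2) by simp
      also have "\<dots> = \<phi> (\<rho> x) + \<kappa> x * D"
        using rk(1)[OF sc[OF that]] Rc L_carrier[OF l(1)] u \<phi>_L[OF l(1)] \<phi>u
        by (subst \<phi>_add; (subst \<phi>_add)?) (auto simp: \<phi>_smult)
      finally have "\<phi> x = \<phi> (\<rho> x) + \<kappa> x * D" .
      moreover have "vmax * int d = vmin * int d + int d * D" by (simp add: D_def algebra_simps)
      ultimately show ?thesis
        using \<phi>_simplex_bounds[OF that] rk(1)[OF sc[OF that]] by (auto simp: K_def)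
    qed
    have inj: "f x = f y" if xy: "x \<in> simplex d" "y \<in> simplex d" "\<rho> x = \<rho> y" "\<kappa> x = \<kappa> y" for x y
    proof -
      obtain l l' where l: "l \<in> L" "x = \<rho> x + (l + \<kappa> x \<cdot>\<^sub>v u)" "l' \<in> L" "y = \<rho> y + (l' + \<kappa> y \<cdot>\<^sub>v u)"
        using rk(2)[OF sc[OF xy(1)]] rk(2)[OF sc[OF xy(2)]] by blast
      have "x - y = l - l'"
      proof -
        have "\<rho> y \<in> carrier_vec ?n" "\<kappa> y \<cdot>\<^sub>v u \<in> carrier_vec ?n" using rk(1)[OF sc[OF xy(2)]] Rc u by auto
        then show ?thesis
          using l(2)[unfolded xy(3,4)] l(4) L_carrier[OF l(1)] L_carrier[OF l(3)] by (auto simp: vec_eq_iff)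
      qed
      also have "\<dots> \<in> L" using l(1,3) by (rule L_diff)
      finally show ?thesis using f that by blast
    qed
    have fS: "finite (Sigma R K)" using finR K(1) by auto
    let ?g = "\<lambda>x. (\<rho> x, \<kappa> x)"
    have gS: "?g ` simplex d \<subseteq> Sigma R K" using in_S by blast
    \<comment> \<open>By \<open>inj\<close>, f factors through the pairs, so its image is no larger
      than the set of pairs that occur.\<close>
    have "\<exists>h. \<forall>x\<in>simplex d. f x = h (?g x)"
      by (intro exI[of _ "\<lambda>y. f (SOME x. x \<in> simplex d \<and> ?g x = y)"] ballI)
        (metis (mono_tags, lifting) inj someI prod.inject)
    then obtain h where h: "\<forall>x\<in>simplex d. f x = h (?g x)" by blast
    have fh: "f ` simplex d = h ` ?g ` simplex d" using h by (auto simp: image_image)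
    have fing: "finite (?g ` simplex d)" using finite_subset[OF gS fS] .
    then have fin: "finite (f ` simplex d)" unfolding fh by (rule finite_imageI)
    have "card (f ` simplex d) \<le> card (?g ` simplex d)" unfolding fh using fing by (rule card_image_le)
    also have "\<dots> \<le> card (Sigma R K)" using card_mono[OF fS gS] .
    also have "\<dots> = (\<Sum>r\<in>R. card (K r))" using finR K(1) by (simp add: card_SigmaI)
    also have "\<dots> \<le> (\<Sum>r\<in>R. d + 1)" by (intro sum_mono K(2))
    also have "\<dots> = nat D * (d + 1)" using R(2) by auto
    finally have upper: "card (f ` simplex d) \<le> nat D * (d + 1)" .
    have lower: "nat D * (d + 1 - d0) \<le> card (f ` simplex d)"
    proof (cases "d0 \<le> d")
      case False
      then show ?thesis by simp
    next
      case True
      define N where "N = d - d0"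
      \<comment> \<open>At most \<open>d0\<close> of the degree is spent on r; the remaining
        \<open>N\<close> is divided between k copies of p and \<open>N - k\<close> copies of q.
        Raising k by one adds u.\<close>
      define g where "g = (\<lambda>(r, k). r + (int k \<cdot>\<^sub>v p + int (N - k) \<cdot>\<^sub>v q))"
      have gs: "g (r, k) \<in> simplex d" if "r \<in> R" "k \<le> N" for r k
      proof -
        have rc: "r \<in> carrier_vec ?n" using Rc that by auto
        have e: "g (r, k) $ j = r $ j + (int k * p $ j + int (N - k) * q $ j)" if "j < ?n" for j
          using rc pc qc that by (auto simp: g_def)
        have "(\<Sum>j<?n. g (r, k) $ j) = (\<Sum>j<?n. r $ j) + (int k * (\<Sum>j<?n. p $ j) + int (N - k) * (\<Sum>j<?n. q $ j))"
          using e by (simp add: sum.distrib sum_distrib_left del: sum.lessThan_Suc)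
        also have "\<dots> \<le> int d0 + (int k * 1 + int (N - k) * 1)"
          using d0[OF that(1)] pq by (intro add_mono mult_left_mono) (auto simp: simplex_def)
        also have "\<dots> = int d" using that True by (simp add: N_def)
        finally show ?thesis using e rc pc qc that Rnn pq by (auto simp: simplex_def g_def)
      qed
      have inj: "inj_on (f \<circ> g) (R \<times> {..N})"
      proof (rule inj_onI, clarsimp)
        fix r k r' k'
        assume rk: "r \<in> R" "k \<le> N" "r' \<in> R" "k' \<le> N" "f (g (r, k)) = f (g (r', k'))"
        have rc: "r \<in> carrier_vec ?n" "r' \<in> carrier_vec ?n" using Rc rk by auto
        define l where "l = g (r, k) - g (r', k')"
        have l: "l \<in> L" unfolding l_def using f gs rk by blast
        note 0 = L_zero
        \<comment> \<open>Both sides take the form residue plus lattice vector plus multiple of u,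
          as \<open>uniq\<close> requires; on the right \<open>l\<close> absorbs everything and the
          multiple is 0.\<close>
        have "r + (0\<^sub>v ?n + (int k - int k') \<cdot>\<^sub>v u) = r' + (l + 0 \<cdot>\<^sub>v u)"
          unfolding l_def g_def u_def using rc pc qc rk by (intro eq_vecI) (auto simp: algebra_simps of_nat_diff)
        then have r: "r = r'" using uniq[OF rk(1,3) 0 l] by blast
        have "l = (int k - int k') \<cdot>\<^sub>v u"
          unfolding l_def g_def u_def r using rc pc qc rk by (intro eq_vecI) (auto simp: algebra_simps of_nat_diff)
        then have "(int k - int k') * D = 0" using \<phi>_L[OF l] \<phi>u \<phi>_smult[OF u] by simp
        then show "r = r' \<and> k = k'" using D r by auto
      qed
      have "nat D * (d + 1 - d0) = card (R \<times> {..N})" using R(2) True by (auto simp: card_cartesian_product N_def Suc_diff_le)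
      also have "\<dots> = card ((f \<circ> g) ` (R \<times> {..N}))" using card_image[OF inj] by simp
      also have "\<dots> \<le> card (f ` simplex d)" using fin gs by (intro card_mono) auto
      finally show ?thesis .
    qed
    from fin upper lower show ?thesis by simp
  qed
  then show ?thesis unfolding D_def by blast
qed

end

section \<open>Polynomials as finitely supported functions\<close>

text \<open>The linear extension of a map of exponents. For a normal form it is reduction of
  polynomials; for an additive map it is a homomorphism of monoid algebras. The first use gives the
  Hilbert function, the second gives prime ideals.\<close>

definition push :: "('a \<Rightarrow> 'b) \<Rightarrow> ('a \<Rightarrow>\<^sub>0 'k::comm_monoid_add) \<Rightarrow> 'b \<Rightarrow>\<^sub>0 'k" where
  "push f p = (\<Sum>m\<in>Poly_Mapping.keys p. Poly_Mapping.single (f m) (Poly_Mapping.lookup p m))"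

lemma push_superset:
  assumes "finite A" "Poly_Mapping.keys p \<subseteq> A"
  shows "push f p = (\<Sum>m\<in>A. Poly_Mapping.single (f m) (Poly_Mapping.lookup p m))"
  unfolding push_def by (rule sum.mono_neutral_left) (use assms in \<open>auto simp: in_keys_iff\<close>)

lemma push_zero [simp]: "push f 0 = 0" by (simp add: push_def)

lemma push_single [simp]: "push f (Poly_Mapping.single m c) = Poly_Mapping.single (f m) c"
  by (cases "c = 0") (simp_all add: push_def)

lemma push_add: "push f (p + q) = push f p + push f q"
proof -
  let ?A = "Poly_Mapping.keys p \<union> Poly_Mapping.keys q"
  have "push f (p + q) = (\<Sum>m\<in>?A. Poly_Mapping.single (f m) (Poly_Mapping.lookup (p + q) m))"
    by (rule push_superset) (use keys_add[of p q] in auto)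
  also have "\<dots> = push f p + push f q"
    using push_superset[of ?A p f] push_superset[of ?A q f]
    by (simp add: lookup_add single_add sum.distrib)
  finally show ?thesis .
qed

lemma push_sum: "push f (sum g A) = (\<Sum>a\<in>A. push f (g a))"
  by (induction A rule: infinite_finite_induct) (auto simp: push_add)

lemma push_minus: "push f (- p) = - push f (p :: _ \<Rightarrow>\<^sub>0 'k::ab_group_add)"
  by (metis add_eq_0_iff push_add push_zero add.right_inverse)

lemma push_diff: "push f (p - q) = push f p - push f (q :: _ \<Rightarrow>\<^sub>0 'k::ab_group_add)"
  using push_add[of f p "- q"] by (simp add: push_minus)

lemma push_id: "push (\<lambda>m. m) p = p"
  by (rule poly_mapping_eqI) (auto simp: push_def lookup_sum lookup_single when_def in_keys_iff sum.delta' if_distrib cong: if_cong)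

lemma poly_mapping_expand: "p = (\<Sum>m\<in>Poly_Mapping.keys p. Poly_Mapping.single m (Poly_Mapping.lookup p m))"
  using push_id[of p] by (simp add: push_def)

lemma keys_push: "Poly_Mapping.keys (push f p) \<subseteq> f ` Poly_Mapping.keys p"
  unfolding push_def by (rule order.trans[OF keys_sum]) auto

lemma push_push: "push f (push g p) = push (f \<circ> g) p"
  by (subst (2) push_def) (simp add: push_sum, simp add: push_def)

lemma push_cong: "(\<And>m. m \<in> Poly_Mapping.keys p \<Longrightarrow> f m = g m) \<Longrightarrow> push f p = push g p"
  by (simp add: push_def)

lemma mult_expand:
  fixes p q :: "'a::monoid_add \<Rightarrow>\<^sub>0 'k::semiring_0"
  shows "p * q = (\<Sum>m\<in>Poly_Mapping.keys p. \<Sum>n\<in>Poly_Mapping.keys q.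
    Poly_Mapping.single (m + n) (Poly_Mapping.lookup p m * Poly_Mapping.lookup q n))"
  by (subst poly_mapping_expand[of p], subst poly_mapping_expand[of q]) (simp add: sum_product mult_single)

lemma push_mult:
  fixes p q :: "'a::monoid_add \<Rightarrow>\<^sub>0 'k::semiring_0"
  shows "push f (p * q) = (\<Sum>m\<in>Poly_Mapping.keys p. \<Sum>n\<in>Poly_Mapping.keys q.
    Poly_Mapping.single (f (m + n)) (Poly_Mapping.lookup p m * Poly_Mapping.lookup q n))"
  by (subst mult_expand) (simp add: push_sum)

lemma push_mult_hom:
  fixes p q :: "'a::monoid_add \<Rightarrow>\<^sub>0 'k::semiring_0"
  assumes "\<And>m n. f (m + n) = f m + (f n :: 'b::monoid_add)"
  shows "push f (p * q) = push f p * push f q"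
  unfolding push_mult unfolding push_def sum_product assms mult_single ..

section \<open>Exponents, total degree and the ring structure\<close>

definition mdeg :: "(nat \<Rightarrow>\<^sub>0 nat) \<Rightarrow> nat" where
  "mdeg m = (\<Sum>j\<in>Poly_Mapping.keys m. Poly_Mapping.lookup m j)"

lemma mdeg_superset: "finite A \<Longrightarrow> Poly_Mapping.keys m \<subseteq> A \<Longrightarrow> mdeg m = (\<Sum>j\<in>A. Poly_Mapping.lookup m j)"
  unfolding mdeg_def by (rule sum.mono_neutral_left) (auto simp: in_keys_iff)

lemma mdeg_add: "mdeg (m + n) = mdeg m + mdeg n"
proof -
  let ?A = "Poly_Mapping.keys m \<union> Poly_Mapping.keys n"
  have "mdeg (m + n) = (\<Sum>j\<in>?A. Poly_Mapping.lookup (m + n) j)"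
    by (rule mdeg_superset) (use keys_add[of m n] in auto)
  then show ?thesis by (simp add: lookup_add sum.distrib mdeg_superset[of ?A m] mdeg_superset[of ?A n])
qed

lemma total_deg_le_mdeg: "total_deg_le d p \<longleftrightarrow> (\<forall>m\<in>Poly_Mapping.keys p. mdeg m \<le> d)"
  by (simp add: total_deg_le_def mdeg_def)

definition exponents :: "nat \<Rightarrow> (nat \<Rightarrow>\<^sub>0 nat) set" where
  "exponents s = {m. Poly_Mapping.keys m \<subseteq> {..<s}}"

lemma exponents_add: "m \<in> exponents s \<Longrightarrow> n \<in> exponents s \<Longrightarrow> m + n \<in> exponents s"
  using keys_add[of m n] by (auto simp: exponents_def)

lemma exponents_zero: "0 \<in> exponents s"
  by (simp add: exponents_def)

lemma carrier_poly_ring: "p \<in> carrier (poly_ring s) \<longleftrightarrow> Poly_Mapping.keys p \<subseteq> exponents s"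
  by (auto simp: poly_ring_def exponents_def)

lemma poly_ring_simps [simp]:
  "mult (poly_ring s) = (*)" "one (poly_ring s) = 1" "zero (poly_ring s) = 0" "add (poly_ring s) = (+)"
  by (simp_all add: poly_ring_def)

lemma poly_ring_closed:
  "p \<in> carrier (poly_ring s) \<Longrightarrow> q \<in> carrier (poly_ring s) \<Longrightarrow> p + q \<in> carrier (poly_ring s)"
  "p \<in> carrier (poly_ring s) \<Longrightarrow> q \<in> carrier (poly_ring s) \<Longrightarrow> p - q \<in> carrier (poly_ring s)"
  "p \<in> carrier (poly_ring s) \<Longrightarrow> q \<in> carrier (poly_ring s) \<Longrightarrow> p * q \<in> carrier (poly_ring s)"
  "p \<in> carrier (poly_ring s) \<Longrightarrow> - p \<in> carrier (poly_ring s)"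
  "0 \<in> carrier (poly_ring s)" "1 \<in> carrier (poly_ring s)"
  "m \<in> exponents s \<Longrightarrow> Poly_Mapping.single m c \<in> carrier (poly_ring s)"
  unfolding carrier_poly_ring
proof -
  assume pq: "Poly_Mapping.keys p \<subseteq> exponents s" "Poly_Mapping.keys q \<subseteq> exponents s"
  show "Poly_Mapping.keys (p + q) \<subseteq> exponents s" using keys_add[of p q] pq by auto
  show "Poly_Mapping.keys (p - q) \<subseteq> exponents s"
    using pq by (auto simp: in_keys_iff lookup_minus subset_iff) (metis diff_self)
  show "Poly_Mapping.keys (p * q) \<subseteq> exponents s"
    using keys_mult[of p q] pq exponents_add by fast
qed (auto simp: exponents_zero in_keys_iff keys_one)

lemma poly_ring_sum:
  "(\<And>a. a \<in> A \<Longrightarrow> f a \<in> carrier (poly_ring s)) \<Longrightarrow> sum f A \<in> carrier (poly_ring s)"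
  by (induction A rule: infinite_finite_induct) (auto simp: poly_ring_closed)

lemma poly_ring_power: "p \<in> carrier (poly_ring s) \<Longrightarrow> p ^ n \<in> carrier (poly_ring s)"
  by (induction n) (auto simp: poly_ring_closed)

lemma mconst_carrier: "mconst c \<in> carrier (poly_ring s)"
  by (simp add: mconst_def poly_ring_closed exponents_zero)

lemma cring_poly_ring: "cring (poly_ring s)"
proof (rule cringI)
  show "abelian_group (poly_ring s)"
    by (rule abelian_groupI) (auto simp: poly_ring_closed add_ac intro!: bexI[of _ "- _"])
  show "comm_monoid (poly_ring s)"
    by (rule comm_monoidI) (auto simp: poly_ring_closed mult_ac)
qed (auto simp: algebra_simps)

lemma poly_ring_minus: "p \<in> carrier (poly_ring s) \<Longrightarrow> \<ominus>\<^bsub>poly_ring s\<^esub> p = - p"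
proof -
  assume p: "p \<in> carrier (poly_ring s)"
  interpret cring "poly_ring s" by (rule cring_poly_ring)
  show ?thesis using p minus_equality[of "- p" p] poly_ring_closed by (simp add: poly_ring_closed)
qed

lemma total_deg_le_mult: "total_deg_le a p \<Longrightarrow> total_deg_le b q \<Longrightarrow> total_deg_le (a + b) (p * q)"
  using keys_mult[of p q] unfolding total_deg_le_mdeg by (fastforce simp: mdeg_add intro: add_mono)

lemma total_deg_le_add: "total_deg_le d p \<Longrightarrow> total_deg_le d q \<Longrightarrow> total_deg_le d (p + q)"
  using keys_add[of p q] unfolding total_deg_le_mdeg by auto

lemma total_deg_le_minus: "total_deg_le d p \<Longrightarrow> total_deg_le d (- p)"
  unfolding total_deg_le_mdeg by (auto simp: in_keys_iff)

lemma total_deg_le_zero: "total_deg_le d 0" and total_deg_le_one: "total_deg_le d 1"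
  unfolding total_deg_le_mdeg by (auto simp: mdeg_def)

lemma total_deg_le_power: "total_deg_le a p \<Longrightarrow> total_deg_le (n * a) (p ^ n)"
  by (induction n) (auto simp: total_deg_le_one intro: total_deg_le_mult)

lemma total_deg_le_mono: "total_deg_le a p \<Longrightarrow> a \<le> b \<Longrightarrow> total_deg_le b p"
  unfolding total_deg_le_mdeg by auto

lemma ex_total_deg_le: "\<exists>d. total_deg_le d p"
  unfolding total_deg_le_mdeg
  by (intro exI[of _ "\<Sum>m\<in>Poly_Mapping.keys p. mdeg m"] ballI member_le_sum) auto

section \<open>Monomial normal forms and the Hilbert function\<close>

lemma mconst_mult_single: "mconst c * Poly_Mapping.single m a = Poly_Mapping.single m (c * a)"
  by (simp add: mconst_def mult_single)

lemma lookup_mconst_mult: "Poly_Mapping.lookup (mconst c * p) m = c * Poly_Mapping.lookup p m"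
proof -
  have "mconst c * p = (\<Sum>m\<in>Poly_Mapping.keys p. Poly_Mapping.single m (c * Poly_Mapping.lookup p m))"
    by (subst poly_mapping_expand[of p]) (simp add: sum_distrib_left mconst_mult_single)
  then show ?thesis
    by (auto simp: lookup_sum lookup_single when_def in_keys_iff sum.delta' cong: if_cong)
qed

lemma push_mconst_mult: "push f (mconst c * p) = mconst c * push f p"
  by (subst poly_mapping_expand[of p])
    (simp add: sum_distrib_left mconst_mult_single push_sum, simp add: push_def sum_distrib_left mconst_mult_single)

lemma total_deg_le_mconst_mult: "total_deg_le d p \<Longrightarrow> total_deg_le d (mconst c * p)"
  unfolding total_deg_le_mdeg by (auto simp: in_keys_iff lookup_mconst_mult)

lemma mconst_arith: "mconst (a + b) = mconst a + mconst b" "mconst (a * b) = mconst a * mconst b"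
  "mconst 1 = 1" "mconst 0 = 0"
  by (simp_all add: mconst_def single_add mult_single)

lemma finite_exponents_le: "finite {m \<in> exponents s. mdeg m \<le> d}"
proof (rule finite_subset)
  show "{m \<in> exponents s. mdeg m \<le> d} \<subseteq>
      (\<lambda>g. \<Sum>j<s. Poly_Mapping.single j (g j)) ` ({..<s} \<rightarrow>\<^sub>E {..d})"
  proof
    fix m assume "m \<in> {m \<in> exponents s. mdeg m \<le> d}"
    then have m: "Poly_Mapping.keys m \<subseteq> {..<s}" "mdeg m \<le> d" by (auto simp: exponents_def)
    have "Poly_Mapping.lookup m j \<le> d" if "j < s" for j
    proof -
      have "Poly_Mapping.lookup m j \<le> (\<Sum>j<s. Poly_Mapping.lookup m j)"
        using that by (intro member_le_sum) auto
      then show ?thesis using m mdeg_superset[OF _ m(1)] by simp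
    qed
    moreover have "m = (\<Sum>j<s. Poly_Mapping.single j (restrict (Poly_Mapping.lookup m) {..<s} j))"
      using push_superset[OF _ m(1), of "\<lambda>j. j"] by (simp add: push_id)
    ultimately show "m \<in> (\<lambda>g. \<Sum>j<s. Poly_Mapping.single j (g j)) ` ({..<s} \<rightarrow>\<^sub>E {..d})"
      by (intro image_eqI[of _ _ "restrict (Poly_Mapping.lookup m) {..<s}"]) auto
  qed
qed (auto intro!: finite_imageI finite_PiE)

text \<open>The condition \<open>add\<close> makes equality of normal forms a congruence on
  exponents, and \<open>deg\<close> makes reduction respect the degree filtration. The Hilbert
  function and the bound on chains of primes rest on these properties alone, without reference to a
  lattice.\<close>

locale monomial_normal_form =
  fixes s :: nat and \<rho> :: "(nat \<Rightarrow>\<^sub>0 nat) \<Rightarrow> (nat \<Rightarrow>\<^sub>0 nat)"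
  assumes closed: "m \<in> exponents s \<Longrightarrow> \<rho> m \<in> exponents s"
    and add: "m \<in> exponents s \<Longrightarrow> n \<in> exponents s \<Longrightarrow> \<rho> (m + \<rho> n) = \<rho> (m + n)"
    and deg: "m \<in> exponents s \<Longrightarrow> mdeg (\<rho> m) \<le> mdeg m"
begin

lemma idem: "m \<in> exponents s \<Longrightarrow> \<rho> (\<rho> m) = \<rho> m"
  using add[of 0 m] exponents_zero by simp

text \<open>The ideal is described as the kernel of reduction, so that membership is decided by
  computation rather than by a search for generators.\<close>

definition nf_ideal :: "'k::field mpoly set" where
  "nf_ideal = {p \<in> carrier (poly_ring s). push \<rho> p = 0}"

definition standard :: "nat \<Rightarrow> (nat \<Rightarrow>\<^sub>0 nat) set" where
  "standard d = \<rho> ` {m \<in> exponents s. mdeg m \<le> d}"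

lemma finite_standard: "finite (standard d)"
  unfolding standard_def by (intro finite_imageI finite_exponents_le)

lemma standardD: "m \<in> standard d \<Longrightarrow> m \<in> exponents s \<and> mdeg m \<le> d \<and> \<rho> m = m"
  unfolding standard_def using closed deg idem by (auto intro: order.trans)

lemma keys_push_standard:
  "p \<in> carrier (poly_ring s) \<Longrightarrow> total_deg_le d p \<Longrightarrow> Poly_Mapping.keys (push \<rho> p) \<subseteq> standard d"
  using keys_push[of \<rho> p] by (auto simp: standard_def carrier_poly_ring total_deg_le_mdeg subset_iff image_iff; blast)

text \<open>By \<open>add\<close>, a factor may be reduced before multiplication; this is why the
  kernel of reduction absorbs products.\<close>

lemma push_mult_right:
  assumes p: "p \<in> carrier (poly_ring s)" and q: "q \<in> carrier (poly_ring s)"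
  shows "push \<rho> (p * push \<rho> q) = push \<rho> (p * q :: 'k::field mpoly)"
proof -
  have "p * push \<rho> q = (\<Sum>m\<in>Poly_Mapping.keys p. \<Sum>n\<in>Poly_Mapping.keys q.
      Poly_Mapping.single (m + \<rho> n) (Poly_Mapping.lookup p m * Poly_Mapping.lookup q n))"
    by (subst poly_mapping_expand[of p]) (simp add: push_def[of _ q] sum_product mult_single)
  then have "push \<rho> (p * push \<rho> q) = (\<Sum>m\<in>Poly_Mapping.keys p. \<Sum>n\<in>Poly_Mapping.keys q.
      Poly_Mapping.single (\<rho> (m + \<rho> n)) (Poly_Mapping.lookup p m * Poly_Mapping.lookup q n))"
    by (simp add: push_sum)
  also have "\<dots> = push \<rho> (p * q)"
    unfolding push_mult using p q add by (intro sum.cong refl arg_cong2[of _ _ _ _ Poly_Mapping.single]) (auto simp: carrier_poly_ring)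
  finally show ?thesis .
qed

lemma ideal_nf_ideal: "ideal (nf_ideal :: 'k::field mpoly set) (poly_ring s)"
proof -
  interpret P: cring "poly_ring s :: 'k mpoly ring" by (rule cring_poly_ring)
  show ?thesis
  proof (rule idealI)
    show "ring (poly_ring s :: 'k mpoly ring)" by (rule P.ring_axioms)
    show "subgroup (nf_ideal :: 'k mpoly set) (add_monoid (poly_ring s))"
    proof (rule P.add.subgroupI)
      show "nf_ideal \<noteq> ({} :: 'k mpoly set)" using poly_ring_closed(5) by (force simp: nf_ideal_def)
    qed (auto simp: nf_ideal_def poly_ring_closed push_add push_minus
        simp flip: a_inv_def simp: poly_ring_minus)
    fix a x :: "'k mpoly"
    assume ax: "a \<in> nf_ideal" "x \<in> carrier (poly_ring s)"
    have "push \<rho> (x * a) = push \<rho> (x * push \<rho> a)" using push_mult_right[of x a] ax by (simp add: nf_ideal_def)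
    then have "x * a \<in> nf_ideal" using ax by (auto simp: nf_ideal_def poly_ring_closed)
    then show "x \<otimes>\<^bsub>poly_ring s\<^esub> a \<in> nf_ideal" "a \<otimes>\<^bsub>poly_ring s\<^esub> x \<in> nf_ideal" by (auto simp: mult.commute)
  qed
qed

text \<open>An element that reduces to zero equals its difference from its own reduction, and term
  by term this difference is a combination of the given binomials.\<close>

lemma nf_ideal_subset_ideal:
  fixes J :: "'k::field mpoly set"
  assumes J: "ideal J (poly_ring s)"
    and bin: "\<And>m. m \<in> exponents s \<Longrightarrow> Poly_Mapping.single m 1 - Poly_Mapping.single (\<rho> m) 1 \<in> J"
  shows "nf_ideal \<subseteq> J"
proof
  interpret J: ideal J "poly_ring s" by (rule J)
  have sumJ: "sum f A \<in> J" if "\<And>a. a \<in> A \<Longrightarrow> f a \<in> J" for f :: "(nat \<Rightarrow>\<^sub>0 nat) \<Rightarrow> 'k mpoly" and A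
  proof -
    have "0 \<in> J" using additive_subgroup.zero_closed[OF J.is_additive_subgroup] by simp
    moreover have "x + y \<in> J" if "x \<in> J" "y \<in> J" for x y
      using additive_subgroup.a_closed[OF J.is_additive_subgroup that] by simp
    ultimately show ?thesis using that by (induction A rule: infinite_finite_induct) auto
  qed
  fix p :: "'k mpoly" assume p: "p \<in> nf_ideal"
  let ?f = "\<lambda>m. mconst (Poly_Mapping.lookup p m) * (Poly_Mapping.single m 1 - Poly_Mapping.single (\<rho> m) 1)"
  have "p = p - push \<rho> p" using p by (simp add: nf_ideal_def)
  also have "\<dots> = (\<Sum>m\<in>Poly_Mapping.keys p. Poly_Mapping.single m (Poly_Mapping.lookup p m)) - push \<rho> p"
    using poly_mapping_expand[of p] by simp
  also have "\<dots> = (\<Sum>m\<in>Poly_Mapping.keys p. ?f m)"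
    by (simp add: push_def sum_subtractf right_diff_distrib mconst_mult_single)
  also have "\<dots> \<in> J"
  proof (rule sumJ)
    fix m assume "m \<in> Poly_Mapping.keys p"
    then have "m \<in> exponents s" using p by (auto simp: nf_ideal_def carrier_poly_ring)
    from J.I_l_closed[OF bin[OF this] mconst_carrier] show "?f m \<in> J" by simp
  qed
  finally show "p \<in> J" .
qed

text \<open>Two polynomials of degree at most d lie in one coset iff their reductions agree. By
  \<open>deg\<close> the reductions lie in the span of \<open>standard d\<close>, so the cosets of
  these monomials generate; reduction fixes the monomials, so their cosets are independent.\<close>

lemma affine_hilbert_nf_ideal:
  "affine_hilbert s (nf_ideal :: 'k::field mpoly set) d = card (standard d)"
proof -
  define M where "M = (poly_space_le s d :: ('k, 'k mpoly) module)"
  define V where "V = {p \<in> carrier (poly_ring s :: 'k mpoly ring). total_deg_le d p}"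
  define N where "N = {p \<in> nf_ideal :: 'k mpoly set. total_deg_le d p}"
  \<comment> \<open>Cosets are handled as fibres of reduction, so that the operations of the
    quotient module can be computed on representatives.\<close>
  define F where "F x = {y \<in> V. push \<rho> y = push \<rho> x}" for x :: "'k mpoly"
  define Q where "Q = quotient_module M N"
  have V: "x + y \<in> V" "x - y \<in> V" if "x \<in> V" "y \<in> V" for x y
    using that total_deg_le_add[of d x "-y"] unfolding V_def
    by (auto simp: poly_ring_closed total_deg_le_add total_deg_le_minus)
  have V1: "- x \<in> V" "mconst c * x \<in> V" if "x \<in> V" for x c
    using that unfolding V_def
    by (auto simp: poly_ring_closed mconst_carrier total_deg_le_minus total_deg_le_mconst_mult)
  have V0: "0 \<in> V" by (simp add: V_def poly_ring_closed total_deg_le_zero)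
  have Vsum: "sum f A \<in> V" if "\<And>a. a \<in> A \<Longrightarrow> f a \<in> V" for f :: "(nat \<Rightarrow>\<^sub>0 nat) \<Rightarrow> 'k mpoly" and A
    using that by (induction A rule: infinite_finite_induct) (auto simp: V V0)
  have M: "carrier M = V" "add M = (+)" "zero M = 0" "module.smult M = (\<lambda>c p. mconst c * p)"
    by (simp_all add: M_def poly_space_le_def V_def)
  have NV: "N = {y \<in> V. push \<rho> y = 0}" by (auto simp: N_def V_def nf_ideal_def)
  have coset: "N +>\<^bsub>M\<^esub> x = F x" if "x \<in> V" for x
  proof -
    have "y \<in> N +>\<^bsub>M\<^esub> x" if "y \<in> F x" for y
    proof -
      have "y - x \<in> N" "y = y - x + x" using \<open>x \<in> V\<close> that by (auto simp: NV F_def V push_diff)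
      then show ?thesis unfolding a_r_coset_def' M by blast
    qed
    moreover have "N +>\<^bsub>M\<^esub> x \<subseteq> F x" using that by (auto simp: a_r_coset_def' M NV F_def V push_add)
    ultimately show ?thesis by blast
  qed
  have Fself: "x \<in> F x" if "x \<in> V" for x using that by (simp add: F_def)
  have Feq: "F x = F y \<longleftrightarrow> push \<rho> x = push \<rho> y" if "x \<in> V" "y \<in> V" for x y
    using that Fself by (auto simp: F_def)
  have Qc: "carrier Q = F ` V"
    using coset by (auto simp: Q_def quotient_module_def A_RCOSETS_def' M)
  have Qz: "zero Q = F 0" by (simp add: Q_def quotient_module_def NV F_def)
  have Qa: "F x \<oplus>\<^bsub>Q\<^esub> F y = F (x + y)" if "x \<in> V" "y \<in> V" for x y
  proof -
    have "F x \<oplus>\<^bsub>Q\<^esub> F y = (\<Union>a\<in>F x. \<Union>b\<in>F y. {a + b})"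
      by (simp add: Q_def quotient_module_def set_add_def' M)
    also have "\<dots> = F (x + y)"
    proof (intro equalityI subsetI)
      fix z assume "z \<in> F (x + y)"
      then have "z - x \<in> F y" using that by (auto simp: F_def V push_diff push_add)
      then show "z \<in> (\<Union>a\<in>F x. \<Union>b\<in>F y. {a + b})"
        using Fself[OF that(1)] by (intro UN_I[of x] UN_I[of "z - x"]) auto
    qed (auto simp: F_def V push_add)
    finally show ?thesis .
  qed
  have Qs: "c \<odot>\<^bsub>Q\<^esub> F x = F (mconst c * x)" if "x \<in> V" for x c
  proof -
    have "c \<odot>\<^bsub>Q\<^esub> F x = (\<Union>w\<in>F x. N +>\<^bsub>M\<^esub> (mconst c * w))"
      by (simp add: Q_def quotient_module_def M)
    \<comment> \<open>All members of a coset lead to the same coset after scaling, so the union runs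
      over a constant family, even for c = 0.\<close>
    also have "\<dots> = (\<Union>w\<in>F x. F (mconst c * x))"
    proof (rule SUP_cong[OF refl])
      fix w assume "w \<in> F x"
      then have w: "w \<in> V" "push \<rho> w = push \<rho> x" by (auto simp: F_def)
      then show "N +>\<^bsub>M\<^esub> (mconst c * w) = F (mconst c * x)"
        using that by (simp add: coset V1 Feq push_mconst_mult)
    qed
    finally show ?thesis using Fself[OF that] by blast
  qed
  have "abelian_group Q"
  proof (rule abelian_groupI)
    fix x assume "x \<in> carrier Q"
    then obtain a where a: "a \<in> V" "x = F a" by (auto simp: Qc)
    then show "\<exists>y\<in>carrier Q. y \<oplus>\<^bsub>Q\<^esub> x = \<zero>\<^bsub>Q\<^esub>"
      by (intro bexI[of _ "F (- a)"]) (auto simp: Qa V1 Qz Qc)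
  qed (auto simp: Qc Qa V V0 Qz add_ac)
  then have "module (class_ring :: 'k ring) Q"
  proof (intro moduleI class_cring.cring_axioms)
    fix a b :: 'k and x y
    assume "x \<in> carrier Q"
    then obtain x' where x: "x' \<in> V" "x = F x'" by (auto simp: Qc)
    show "a \<odot>\<^bsub>Q\<^esub> x \<in> carrier Q" using x V1 by (simp add: Qs Qc)
    show "(a \<oplus>\<^bsub>class_ring\<^esub> b) \<odot>\<^bsub>Q\<^esub> x = a \<odot>\<^bsub>Q\<^esub> x \<oplus>\<^bsub>Q\<^esub> b \<odot>\<^bsub>Q\<^esub> x"
      using x V1 by (simp add: Qs Qa mconst_arith distrib_right)
    show "(a \<otimes>\<^bsub>class_ring\<^esub> b) \<odot>\<^bsub>Q\<^esub> x = a \<odot>\<^bsub>Q\<^esub> (b \<odot>\<^bsub>Q\<^esub> x)"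
      using x V1 by (simp add: Qs mconst_arith mult.assoc)
    show "\<one>\<^bsub>class_ring\<^esub> \<odot>\<^bsub>Q\<^esub> x = x" using x by (simp add: Qs mconst_arith)
    assume "y \<in> carrier Q"
    then obtain y' where y: "y' \<in> V" "y = F y'" by (auto simp: Qc)
    show "a \<odot>\<^bsub>Q\<^esub> (x \<oplus>\<^bsub>Q\<^esub> y) = a \<odot>\<^bsub>Q\<^esub> x \<oplus>\<^bsub>Q\<^esub> a \<odot>\<^bsub>Q\<^esub> y"
      using x y V V1 by (simp add: Qs Qa distrib_left)
  qed
  then interpret Q: vectorspace "class_ring :: 'k ring" Q
    by (intro vectorspace.intro class_field)
  have finsum: "finsum Q (\<lambda>a. F (f a)) A = F (sum f A)" if "finite A" "\<And>a. a \<in> A \<Longrightarrow> f a \<in> V"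
    for f :: "(nat \<Rightarrow>\<^sub>0 nat) \<Rightarrow> 'k mpoly" and A
    using that
  proof (induction A rule: finite_induct)
    case empty
    then show ?case by (simp add: Qz)
  next
    case (insert a A)
    have "sum f A \<in> V" using insert.prems by (intro Vsum) auto
    then show ?case using insert by (subst Q.finsum_insert) (auto simp: Qc Qa)
  qed
  define b where "b m = F (Poly_Mapping.single m 1)" for m
  have mono_V: "Poly_Mapping.single m c \<in> V" if "m \<in> standard d" for m c
    using standardD[OF that] by (auto simp: V_def poly_ring_closed total_deg_le_mdeg)
  have inj: "inj_on b (standard d)"
  proof (rule inj_onI)
    fix m n assume mn: "m \<in> standard d" "n \<in> standard d" "b m = b n"
    then have "Poly_Mapping.single m (1::'k) = Poly_Mapping.single n 1"
      using Feq[OF mono_V mono_V, of m n 1 1] standardD by (auto simp: b_def)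
    then show "m = n" by (metis lookup_single_eq lookup_single_not_eq zero_neq_one)
  qed
  let ?A = "b ` standard d"
  have A: "?A \<subseteq> carrier Q" "finite ?A" using mono_V finite_standard by (auto simp: b_def Qc)
  have lc: "Q.lincomb a ?A = F (\<Sum>m\<in>standard d. Poly_Mapping.single m (a (b m)))" for a
  proof -
    have "Q.lincomb a ?A = finsum Q (\<lambda>m. a (b m) \<odot>\<^bsub>Q\<^esub> b m) (standard d)"
      unfolding Q.lincomb_def
      by (rule Q.finsum_reindex) (use A inj Q.smult_closed in \<open>auto simp: class_ring_simps\<close>)
    also have "\<dots> = finsum Q (\<lambda>m. F (Poly_Mapping.single m (a (b m)))) (standard d)"
    proof (rule Q.finsum_cong')
      fix m assume "m \<in> standard d"
      then show "a (b m) \<odot>\<^bsub>Q\<^esub> b m = F (Poly_Mapping.single m (a (b m)))"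
        using mono_V by (simp add: b_def Qs mconst_mult_single)
    qed (use mono_V in \<open>auto simp: Qc\<close>)
    also have "\<dots> = F (\<Sum>m\<in>standard d. Poly_Mapping.single m (a (b m)))"
      by (rule finsum[OF finite_standard mono_V])
    finally show ?thesis .
  qed
  have sumV: "(\<Sum>m\<in>standard d. Poly_Mapping.single m (c m)) \<in> V" for c
    using mono_V by (rule Vsum)
  have push_std: "push \<rho> (\<Sum>m\<in>standard d. Poly_Mapping.single m (c m)) = (\<Sum>m\<in>standard d. Poly_Mapping.single m (c m))" for c :: "_ \<Rightarrow> 'k"
    unfolding push_sum by (rule sum.cong) (auto simp: standardD)
  have "Q.basis ?A"
    unfolding Q.basis_def
  proof (intro conjI A(1))
    show "Q.lin_indpt ?A"
    proof (rule Q.finite_lin_indpt2[OF A(2,1)])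
      fix a :: "'k mpoly set \<Rightarrow> 'k"
      assume "Q.lincomb a ?A = \<zero>\<^bsub>Q\<^esub>"
      then have "F (\<Sum>m\<in>standard d. Poly_Mapping.single m (a (b m))) = F 0" unfolding lc Qz .
      then have "(\<Sum>m\<in>standard d. Poly_Mapping.single m (a (b m))) = 0"
        unfolding Feq[OF sumV V0] push_std by simp
      then have z: "Poly_Mapping.lookup (\<Sum>m\<in>standard d. Poly_Mapping.single m (a (b m))) n = 0" for n by simp
      have "a (b n) = 0" if "n \<in> standard d" for n
        using z[of n] that finite_standard
        by (auto simp: lookup_sum lookup_single when_def sum.delta' cong: if_cong)
      then show "\<forall>v\<in>?A. a v = \<zero>\<^bsub>class_ring\<^esub>" by (auto simp: class_ring_simps)
    qed
    show "Q.gen_set ?A"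
    proof
      show "Q.span ?A \<subseteq> carrier Q" by (rule Q.span_is_subset2[OF A(1)])
      show "carrier Q \<subseteq> Q.span ?A"
      proof
        fix X assume "X \<in> carrier Q"
        then obtain x where x: "x \<in> V" "X = F x" by (auto simp: Qc)
        \<comment> \<open>Coefficients in a linear combination are attached to the basis cosets, so
          those of the reduction are transported along the injection \<open>b\<close>.\<close>
        define a where "a = (\<lambda>v. Poly_Mapping.lookup (push \<rho> x) (inv_into (standard d) b v))"
        have "push \<rho> x = (\<Sum>m\<in>standard d. Poly_Mapping.single m (Poly_Mapping.lookup (push \<rho> x) m))"
          using push_superset[OF finite_standard, of "push \<rho> x" d "\<lambda>m. m"] keys_push_standard[of x d] x
          by (auto simp: push_id V_def)
        also have "\<dots> = (\<Sum>m\<in>standard d. Poly_Mapping.single m (a (b m)))"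
          by (rule sum.cong) (auto simp: a_def inj)
        finally have "push \<rho> x = (\<Sum>m\<in>standard d. Poly_Mapping.single m (a (b m)))" .
        then have "X = Q.lincomb a ?A" unfolding lc x(2) Feq[OF x(1) sumV] push_std .
        then show "X \<in> Q.span ?A" unfolding Q.finite_span[OF A(2,1)] by (auto simp: class_ring_simps)
      qed
    qed
  qed
  then have "Q.dim = card ?A" using Q.dim_basis[OF A(2)] by simp
  also have "\<dots> = card (standard d)" using card_image[OF inj] .
  finally show ?thesis unfolding affine_hilbert_def Q_def M_def N_def .
qed

end

section \<open>Krull dimension\<close>

lemma carrier_Quot:
  fixes R (structure)
  shows "carrier (R Quot I) = (+>) I ` carrier R"
  by (auto simp: FactRing_def A_RCOSETS_def')

lemma zero_Quot: "\<zero>\<^bsub>R Quot I\<^esub> = I"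
  by (simp add: FactRing_def)

lemma primeideal_preimage_Quot:
  fixes R (structure)
  assumes R: "cring R" and I: "ideal I R" and P: "primeideal P (R Quot I)"
  shows "primeideal {r \<in> carrier R. I +> r \<in> P} R"
proof -
  interpret cring R by (rule R)
  interpret I: ideal I R by (rule I)
  interpret h: ring_hom_cring R "R Quot I" "(+>) I" by (rule I.rcos_ring_hom_cring[OF R])
  interpret P: primeideal P "R Quot I" by (rule P)
  note carr = carrier_Quot[of R I]
  have sub: "subgroup {r \<in> carrier R. I +> r \<in> P} (add_monoid R)"
  proof (rule add.subgroupI)
    have "\<zero> \<in> {r \<in> carrier R. I +> r \<in> P}"
      using additive_subgroup.zero_closed[OF P.is_additive_subgroup] h.hom_zero by simp
    then show "{r \<in> carrier R. I +> r \<in> P} \<noteq> {}" by blast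
    show "\<ominus> a \<in> {r \<in> carrier R. I +> r \<in> P}" if "a \<in> {r \<in> carrier R. I +> r \<in> P}" for a
      using that additive_subgroup.a_inv_closed[OF P.is_additive_subgroup] h.hom_a_inv by simp
    show "a \<oplus> b \<in> {r \<in> carrier R. I +> r \<in> P}"
      if "a \<in> {r \<in> carrier R. I +> r \<in> P}" "b \<in> {r \<in> carrier R. I +> r \<in> P}" for a b
      using that additive_subgroup.a_closed[OF P.is_additive_subgroup] h.hom_add by simp
  qed auto
  show ?thesis
  proof (rule primeidealI[OF idealI[OF ring_axioms sub] R])
    fix a x assume "a \<in> {r \<in> carrier R. I +> r \<in> P}" "x \<in> carrier R"
    then show "x \<otimes> a \<in> {r \<in> carrier R. I +> r \<in> P}" "a \<otimes> x \<in> {r \<in> carrier R. I +> r \<in> P}"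
      using P.I_l_closed[of "I +> a" "I +> x"] P.I_r_closed[of "I +> a" "I +> x"]
        h.hom_mult[of x a] h.hom_mult[of a x] h.hom_closed[of x] by auto
  next
    show "carrier R \<noteq> {r \<in> carrier R. I +> r \<in> P}"
      using P.I_notcarr P.a_subset unfolding carr by blast
  next
    fix a b assume ab: "a \<in> carrier R" "b \<in> carrier R" "a \<otimes> b \<in> {r \<in> carrier R. I +> r \<in> P}"
    then have "(I +> a) \<otimes>\<^bsub>R Quot I\<^esub> (I +> b) \<in> P" using h.hom_mult[of a b] by simp
    then show "a \<in> {r \<in> carrier R. I +> r \<in> P} \<or> b \<in> {r \<in> carrier R. I +> r \<in> P}"
      using P.I_prime[of "I +> a" "I +> b"] ab h.hom_closed by auto
  qed
qed

text \<open>Since \<open>Q\<close> contains \<open>I\<close>, it is a union of cosets of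
  \<open>I\<close>, and any representative decides membership.\<close>

lemma coset_mem_image_ideal_iff:
  fixes R (structure)
  assumes R: "cring R" and I: "ideal I R" and Q: "ideal Q R" and IQ: "I \<subseteq> Q" and r: "r \<in> carrier R"
  shows "I +> r \<in> (+>) I ` Q \<longleftrightarrow> r \<in> Q"
proof
  interpret cring R by (rule R)
  interpret Q: ideal Q R by (rule Q)
  assume "I +> r \<in> (+>) I ` Q"
  then obtain q where q: "q \<in> Q" "I +> r = I +> q" by auto
  then have "r \<ominus> q \<in> Q" using quotient_eq_iff_same_a_r_cos[OF I r] IQ Q.Icarr by blast
  then have "(r \<ominus> q) \<oplus> q \<in> Q"
    using q(1) by (intro additive_subgroup.a_closed[OF Q.is_additive_subgroup])
  moreover have "(r \<ominus> q) \<oplus> q = r" using r Q.Icarr[OF q(1)] by (simp add: a_minus_def a_assoc l_neg)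
  ultimately show "r \<in> Q" by simp
qed auto

lemma primeideal_image_Quot:
  fixes R (structure)
  assumes R: "cring R" and I: "ideal I R" and Q: "primeideal Q R" and IQ: "I \<subseteq> Q"
  shows "primeideal ((+>) I ` Q) (R Quot I)"
proof -
  interpret cring R by (rule R)
  interpret I: ideal I R by (rule I)
  interpret h: ring_hom_cring R "R Quot I" "(+>) I" by (rule I.rcos_ring_hom_cring[OF R])
  interpret Q: primeideal Q R by (rule Q)
  note mem = coset_mem_image_ideal_iff[OF R I Q.is_ideal IQ]
  note carr = carrier_Quot[of R I]
  have sub: "subgroup ((+>) I ` Q) (add_monoid (R Quot I))"
  proof (rule h.S.add.subgroupI)
    show "(+>) I ` Q \<noteq> {}" using additive_subgroup.zero_closed[OF Q.is_additive_subgroup] by blast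
    show "(+>) I ` Q \<subseteq> carrier (R Quot I)" using Q.a_subset carr by auto
    fix a assume "a \<in> (+>) I ` Q"
    then obtain a' where a: "a' \<in> Q" "a = I +> a'" by blast
    have "\<ominus>\<^bsub>R Quot I\<^esub> a = I +> (\<ominus> a')" using h.hom_a_inv[OF Q.Icarr[OF a(1)]] a(2) by simp
    then show "\<ominus>\<^bsub>R Quot I\<^esub> a \<in> (+>) I ` Q"
      using additive_subgroup.a_inv_closed[OF Q.is_additive_subgroup a(1)] by blast
    fix b assume "b \<in> (+>) I ` Q"
    then obtain b' where b: "b' \<in> Q" "b = I +> b'" by blast
    have "a \<oplus>\<^bsub>R Quot I\<^esub> b = I +> (a' \<oplus> b')"
      using h.hom_add[OF Q.Icarr[OF a(1)] Q.Icarr[OF b(1)]] a(2) b(2) by simp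
    then show "a \<oplus>\<^bsub>R Quot I\<^esub> b \<in> (+>) I ` Q"
      using additive_subgroup.a_closed[OF Q.is_additive_subgroup a(1) b(1)] by blast
  qed
  show ?thesis
  proof (rule primeidealI[OF idealI[OF h.S.ring_axioms sub] h.S.cring_axioms])
    fix a x assume "a \<in> (+>) I ` Q" "x \<in> carrier (R Quot I)"
    then obtain a' x' where ax: "a' \<in> Q" "a = I +> a'" "x' \<in> carrier R" "x = I +> x'" using carr by auto
    have "x \<otimes>\<^bsub>R Quot I\<^esub> a = I +> (x' \<otimes> a')" "a \<otimes>\<^bsub>R Quot I\<^esub> x = I +> (a' \<otimes> x')"
      using h.hom_mult[OF ax(3) Q.Icarr[OF ax(1)]] h.hom_mult[OF Q.Icarr[OF ax(1)] ax(3)] ax(2,4) by simp_all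
    then show "x \<otimes>\<^bsub>R Quot I\<^esub> a \<in> (+>) I ` Q" "a \<otimes>\<^bsub>R Quot I\<^esub> x \<in> (+>) I ` Q"
      using Q.I_l_closed[OF ax(1,3)] Q.I_r_closed[OF ax(1,3)] by blast+
  next
    obtain r where "r \<in> carrier R" "r \<notin> Q" using Q.I_notcarr Q.a_subset by blast
    then show "carrier (R Quot I) \<noteq> (+>) I ` Q" using mem[of r] carr by blast
  next
    fix a b assume ab: "a \<in> carrier (R Quot I)" "b \<in> carrier (R Quot I)" "a \<otimes>\<^bsub>R Quot I\<^esub> b \<in> (+>) I ` Q"
    then obtain a' b' where ab': "a' \<in> carrier R" "a = I +> a'" "b' \<in> carrier R" "b = I +> b'" using carr by auto
    then have "I +> (a' \<otimes> b') \<in> (+>) I ` Q" using ab h.hom_mult[of a' b'] by simp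
    then have "a' \<otimes> b' \<in> Q" using mem[of "a' \<otimes> b'"] ab' by simp
    then show "a \<in> (+>) I ` Q \<or> b \<in> (+>) I ` Q" using Q.I_prime ab' by blast
  qed
qed

text \<open>Chains are carried over by preimage and image under the projection. Strict inclusions
  survive preimages because the projection is surjective, and survive images because the ideals
  contain \<open>I\<close>.\<close>

lemma krull_dim_Quot:
  fixes R (structure)
  assumes R: "cring R" and I: "ideal I R"
  shows "krull_dim (R Quot I) =
    Sup {enat n | n Q. (\<forall>i\<le>n. primeideal (Q i) R \<and> I \<subseteq> Q i) \<and> (\<forall>i<n. Q i \<subset> Q (Suc i))}"
proof -
  interpret cring R by (rule R)
  interpret I: ideal I R by (rule I)
  interpret h: ring_hom_cring R "R Quot I" "(+>) I" by (rule I.rcos_ring_hom_cring[OF R])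
  note carr = carrier_Quot[of R I]
  have "(\<exists>P. (\<forall>i\<le>n. primeideal (P i) (R Quot I)) \<and> (\<forall>i<n. P i \<subset> P (Suc i))) \<longleftrightarrow>
      (\<exists>Q. (\<forall>i\<le>n. primeideal (Q i) R \<and> I \<subseteq> Q i) \<and> (\<forall>i<n. Q i \<subset> Q (Suc i)))" for n :: nat
  proof
    assume "\<exists>P. (\<forall>i\<le>n. primeideal (P i) (R Quot I)) \<and> (\<forall>i<n. P i \<subset> P (Suc i))"
    then obtain P where P: "\<forall>i\<le>n. primeideal (P i) (R Quot I)" and PS: "\<forall>i<n. P i \<subset> P (Suc i)" by blast
    let ?Q = "\<lambda>i. {r \<in> carrier R. I +> r \<in> P i}"
    have "primeideal (?Q i) R \<and> I \<subseteq> ?Q i" if "i \<le> n" for i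
    proof
      interpret P: primeideal "P i" "R Quot I" by (rule P[rule_format, OF that])
      show "primeideal (?Q i) R" by (rule primeideal_preimage_Quot[OF R I P.primeideal_axioms])
      have "I \<in> P i"
        using additive_subgroup.zero_closed[OF P.is_additive_subgroup] unfolding zero_Quot .
      then show "I \<subseteq> ?Q i" using I.a_rcos_const I.Icarr by (intro subsetI CollectI conjI) simp_all
    qed
    moreover have "?Q i \<subset> ?Q (Suc i)" if i: "i < n" for i
    proof -
      have "P i \<subset> P (Suc i)" using PS i by blast
      moreover have "P (Suc i) \<subseteq> (+>) I ` carrier R"
      proof -
        interpret P: primeideal "P (Suc i)" "R Quot I" using P[rule_format, of "Suc i"] i by simp
        show ?thesis using P.a_subset unfolding carr .
      qed
      ultimately show ?thesis by blast
    qed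
    ultimately show "\<exists>Q. (\<forall>i\<le>n. primeideal (Q i) R \<and> I \<subseteq> Q i) \<and> (\<forall>i<n. Q i \<subset> Q (Suc i))"
      by (intro exI[of _ ?Q]) blast
  next
    assume "\<exists>Q. (\<forall>i\<le>n. primeideal (Q i) R \<and> I \<subseteq> Q i) \<and> (\<forall>i<n. Q i \<subset> Q (Suc i))"
    then obtain Q where Q: "\<forall>i\<le>n. primeideal (Q i) R \<and> I \<subseteq> Q i" and QS: "\<forall>i<n. Q i \<subset> Q (Suc i)" by blast
    have "(+>) I ` Q i \<subset> (+>) I ` Q (Suc i)" if i: "i < n" for i
    proof -
      interpret Qi: primeideal "Q i" R using Q[rule_format, of i] i by simp
      interpret QS: primeideal "Q (Suc i)" R using Q[rule_format, of "Suc i"] i by simp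
      obtain r where r: "r \<in> Q (Suc i)" "r \<notin> Q i" using QS i by blast
      then have "I +> r \<notin> (+>) I ` Q i"
        using coset_mem_image_ideal_iff[OF R I Qi.is_ideal] Q i QS.Icarr by simp
      then show ?thesis using r QS i by blast
    qed
    then show "\<exists>P. (\<forall>i\<le>n. primeideal (P i) (R Quot I)) \<and> (\<forall>i<n. P i \<subset> P (Suc i))"
      using Q primeideal_image_Quot[OF R I] by (intro exI[of _ "\<lambda>i. (+>) I ` Q i"] conjI allI impI) simp_all
  qed
  then have "{enat n | n P. (\<forall>i\<le>n. primeideal (P i) (R Quot I)) \<and> (\<forall>i<n. P i \<subset> P (Suc i))} =
      {enat n | n Q. (\<forall>i\<le>n. primeideal (Q i) R \<and> I \<subseteq> Q i) \<and> (\<forall>i<n. Q i \<subset> Q (Suc i))}"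
    by simp
  then show ?thesis unfolding krull_dim_def by (rule arg_cong)
qed

text \<open>Zero rows complete the coefficients to a square matrix. At least one such row is
  present, so the determinant vanishes and a kernel vector exists.\<close>

lemma underdetermined_system_nontrivial:
  fixes M :: "'a \<Rightarrow> 'b \<Rightarrow> 'k::field"
  assumes A: "finite A" and S: "finite S" and lt: "card S < card A"
  shows "\<exists>c. (\<exists>a\<in>A. c a \<noteq> 0) \<and> (\<forall>t\<in>S. (\<Sum>a\<in>A. M t a * c a) = 0)"
proof -
  let ?n = "card A" and ?k = "card S"
  obtain f where f: "bij_betw f {0..<?n} A" using ex_bij_betw_nat_finite[OF A] by blast
  obtain g where g: "bij_betw g {0..<?k} S" using ex_bij_betw_nat_finite[OF S] by blast
  define W where "W = mat ?n ?n (\<lambda>(i, j). if i < ?k then M (g i) (f j) else 0)"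
  have W: "W \<in> carrier_mat ?n ?n" by (simp add: W_def)
  have "det W = 0"
    using lt by (subst laplace_expansion_row[OF W lt]) (simp add: W_def)
  then obtain x where x: "x \<in> carrier_vec ?n" "x \<noteq> 0\<^sub>v ?n" "W *\<^sub>v x = 0\<^sub>v ?n"
    using det_0_iff_vec_prod_zero[OF W] by blast
  define c where "c a = x $ inv_into {0..<?n} f a" for a
  have cf: "c (f j) = x $ j" if "j < ?n" for j
    using that f by (simp add: c_def bij_betw_def inv_into_f_f)
  obtain j where j: "j < ?n" "x $ j \<noteq> 0" using x(1,2) by (auto simp: vec_eq_iff)
  have "(\<Sum>a\<in>A. M t a * c a) = 0" if t: "t \<in> S" for t
  proof -
    have "t \<in> g ` {0..<?k}" using g t by (simp add: bij_betw_def)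
    then obtain i where i: "i < ?k" "t = g i" by auto
    have "(\<Sum>a\<in>A. M t a * c a) = (\<Sum>j = 0..<?n. M t (f j) * c (f j))"
      by (rule sum.reindex_bij_betw[OF f, symmetric])
    also have "\<dots> = (W *\<^sub>v x) $ i"
      using i lt x(1) cf by (simp add: W_def scalar_prod_def)
    also have "\<dots> = 0" using x(3) i lt by simp
    finally show ?thesis .
  qed
  moreover have "f j \<in> A" "c (f j) \<noteq> 0" using f j cf by (auto simp: bij_betw_def)
  ultimately show ?thesis by blast
qed

text \<open>Modulo the prime \<open>P\<close> the relation may be divided by x, which is not in
  \<open>P\<close>, until \<open>g a0\<close> is its constant term. Then \<open>g a0\<close> is a
  multiple of x modulo \<open>P\<close>, and both x and \<open>P\<close> lie in
  \<open>P'\<close>.\<close>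

lemma lowest_coeff_mem_ideal:
  fixes x :: "'k::field mpoly" and g :: "nat \<Rightarrow> 'k mpoly"
  assumes P: "primeideal P (poly_ring s)" and P': "ideal P' (poly_ring s)" "P \<subseteq> P'"
    and x: "x \<in> P'" "x \<notin> P" and g: "\<And>a. g a \<in> carrier (poly_ring s)"
    and sum: "(\<Sum>a\<le>n. g a * x ^ a) \<in> P" and a0: "a0 \<le> n" "\<And>a. a < a0 \<Longrightarrow> g a = 0"
  shows "g a0 \<in> P'"
  using g sum a0
proof (induction a0 arbitrary: g n)
  case 0
  interpret P': ideal P' "poly_ring s" by (rule P')
  have xc: "x \<in> carrier (poly_ring s)" using P'.Icarr x by blast
  define h where "h = (\<Sum>a<n. g (Suc a) * x ^ a)"
  have h: "h \<in> carrier (poly_ring s)"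
    unfolding h_def using "0.prems" xc by (intro poly_ring_sum poly_ring_closed poly_ring_power)
  have "(\<Sum>a\<le>n. g a * x ^ a) = g 0 + h * x"
    by (cases n) (simp_all add: h_def sum.atMost_Suc_shift sum_distrib_right lessThan_Suc_atMost
      power_commutes mult.assoc del: sum.atMost_Suc sum.lessThan_Suc)
  then have "g 0 + h * x \<in> P'" using "0.prems" P'(2) by auto
  moreover have "(- h) * x \<in> P'"
    using P'.I_l_closed[OF x(1), of "- h"] poly_ring_closed(4)[OF h] by simp
  ultimately have "(g 0 + h * x) + (- h) * x \<in> P'"
    using additive_subgroup.a_closed[OF P'.is_additive_subgroup] by fastforce
  then show ?case by simp
next
  case (Suc a0)
  interpret P: primeideal P "poly_ring s" by (rule P)
  interpret P': ideal P' "poly_ring s" by (rule P')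
  have xc: "x \<in> carrier (poly_ring s)" using P'.Icarr x by blast
  obtain n' where n: "n = Suc n'" using Suc.prems by (cases n) auto
  define h where "h = (\<Sum>a\<le>n'. g (Suc a) * x ^ a)"
  have h: "h \<in> carrier (poly_ring s)"
    unfolding h_def using Suc.prems xc by (intro poly_ring_sum poly_ring_closed poly_ring_power)
  have "(\<Sum>a\<le>n. g a * x ^ a) = x * h"
    using Suc.prems(4)[of 0] by (simp add: n h_def sum.atMost_Suc_shift sum_distrib_left mult.left_commute mult.commute[of _ x] mult.assoc del: sum.atMost_Suc)
  then have "h \<in> P" using Suc.prems(2) P.I_prime[OF xc h] x(2) by auto
  then show ?case using Suc.IH[of "\<lambda>a. g (Suc a)" n'] Suc.prems by (simp add: h_def n)
qed

section \<open>Chains of primes and the growth of the Hilbert function\<close>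

context monomial_normal_form
begin

text \<open>The reductions of all \<open>f a\<close> lie in the span of \<open>standard d\<close>, a
  space of smaller dimension than the number of polynomials.\<close>

lemma linear_relation_mod_nf_ideal:
  fixes f :: "'a \<Rightarrow> 'k::field mpoly"
  assumes A: "finite A" and f: "\<And>a. a \<in> A \<Longrightarrow> f a \<in> carrier (poly_ring s) \<and> total_deg_le d (f a)"
    and lt: "card (standard d) < card A"
  shows "\<exists>c. (\<exists>a\<in>A. c a \<noteq> 0) \<and> (\<Sum>a\<in>A. mconst (c a) * f a) \<in> nf_ideal"
proof -
  obtain c where c: "\<exists>a\<in>A. c a \<noteq> 0"
    "\<And>t. t \<in> standard d \<Longrightarrow> (\<Sum>a\<in>A. Poly_Mapping.lookup (push \<rho> (f a)) t * c a) = 0"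
    using underdetermined_system_nontrivial[OF A finite_standard lt, of "\<lambda>t a. Poly_Mapping.lookup (push \<rho> (f a)) t"]
    by blast
  have "push \<rho> (\<Sum>a\<in>A. mconst (c a) * f a) = 0"
  proof (rule poly_mapping_eqI)
    fix t
    have "Poly_Mapping.lookup (push \<rho> (\<Sum>a\<in>A. mconst (c a) * f a)) t =
        (\<Sum>a\<in>A. Poly_Mapping.lookup (push \<rho> (f a)) t * c a)"
      by (simp add: push_sum push_mconst_mult lookup_sum lookup_mconst_mult) (simp add: mult.commute)
    also have "\<dots> = 0"
    proof (cases "t \<in> standard d")
      case False
      then have "Poly_Mapping.lookup (push \<rho> (f a)) t = 0" if "a \<in> A" for a
        using keys_push_standard[of "f a" d] f[OF that] by (auto simp: in_keys_iff subset_iff)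
      then show ?thesis by simp
    qed (rule c(2))
    finally show "Poly_Mapping.lookup (push \<rho> (\<Sum>a\<in>A. mconst (c a) * f a)) t = Poly_Mapping.lookup 0 t" by simp
  qed
  moreover have "(\<Sum>a\<in>A. mconst (c a) * f a) \<in> carrier (poly_ring s)"
    using f by (intro poly_ring_sum poly_ring_closed mconst_carrier) auto
  ultimately show ?thesis using c(1) by (auto simp: nf_ideal_def)
qed

text \<open>Elements \<open>x \<in> Q1 - Q0\<close> and \<open>y \<in> Q2 - Q1\<close> are algebraically independent modulo \<open>Q0\<close>, which
  forces quadratic growth of the Hilbert function.\<close>

lemma no_prime_chain_of_length_2:
  fixes Q0 Q1 Q2 :: "'k::field mpoly set"
  assumes bound: "\<And>d. card (standard d) \<le> C * (d + 1)"
    and Q: "primeideal Q0 (poly_ring s)" "primeideal Q1 (poly_ring s)" "primeideal Q2 (poly_ring s)"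
    and sub: "nf_ideal \<subseteq> Q0" "Q0 \<subset> Q1" "Q1 \<subset> Q2"
  shows False
proof -
  interpret Q0: primeideal Q0 "poly_ring s" by (rule Q)
  interpret Q1: primeideal Q1 "poly_ring s" by (rule Q)
  interpret Q2: primeideal Q2 "poly_ring s" by (rule Q)
  obtain x y where x: "x \<in> Q1" "x \<notin> Q0" and y: "y \<in> Q2" "y \<notin> Q1" using sub by blast
  have xc: "x \<in> carrier (poly_ring s)" and yc: "y \<in> carrier (poly_ring s)"
    using Q1.Icarr[OF x(1)] Q2.Icarr[OF y(1)] by auto
  obtain dx dy where dxy: "total_deg_le dx x" "total_deg_le dy y" using ex_total_deg_le by metis
  define e where "e = dx + dy"
  \<comment> \<open>Chosen so that the linear bound in degree n e loses against the number of
    monomials in x and y: C (n e + 1) \<le> C (e + 1) (n + 1) = n (n + 1) < (n + 1)^2.\<close>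
  define n where "n = C * (e + 1)"
  let ?A = "{..n} \<times> {..n}"
  let ?f = "\<lambda>(a, b). x ^ a * y ^ b"
  have "card (standard (n * e)) \<le> C * (n * e + 1)" by (rule bound)
  also have "\<dots> \<le> C * ((e + 1) * (n + 1))" by (intro mult_left_mono) (auto simp: algebra_simps)
  also have "\<dots> = n * (n + 1)" by (simp add: n_def algebra_simps)
  also have "\<dots> < card ?A" by simp
  finally have lt: "card (standard (n * e)) < card ?A" .
  have "?f ab \<in> carrier (poly_ring s) \<and> total_deg_le (n * e) (?f ab)" if ab': "ab \<in> ?A" for ab
  proof -
    obtain a b where ab: "ab = (a, b)" "a \<le> n" "b \<le> n" using ab' by auto
    have "total_deg_le (a * dx + b * dy) (x ^ a * y ^ b)"
      by (intro total_deg_le_mult total_deg_le_power dxy)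
    moreover have "a * dx + b * dy \<le> n * e"
      using ab by (auto simp: e_def distrib_left intro!: add_mono mult_right_mono)
    ultimately show ?thesis
      using ab xc yc by (auto intro: total_deg_le_mono poly_ring_closed poly_ring_power)
  qed
  then obtain c :: "nat \<times> nat \<Rightarrow> 'k" where c: "\<exists>ab\<in>?A. c ab \<noteq> 0" "(\<Sum>ab\<in>?A. mconst (c ab) * ?f ab) \<in> nf_ideal"
    using linear_relation_mod_nf_ideal[of ?A ?f "n * e"] lt by auto
  define g where "g a = (\<Sum>b\<le>n. mconst (c (a, b)) * y ^ b)" for a
  have gc: "g a \<in> carrier (poly_ring s)" for a
    unfolding g_def using yc by (intro poly_ring_sum poly_ring_closed poly_ring_power mconst_carrier)
  have "(\<Sum>ab\<in>?A. mconst (c ab) * ?f ab) = (\<Sum>a\<le>n. g a * x ^ a)"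
    unfolding g_def sum_distrib_right sum.cartesian_product by (rule sum.cong) (auto simp: ac_simps)
  then have g0: "(\<Sum>a\<le>n. g a * x ^ a) \<in> Q0" using c(2) sub(1) by auto
  \<comment> \<open>Minimality refers to the scalars \<open>c\<close>, not to the polynomials
    \<open>g a\<close>: \<open>g a0\<close> may itself be zero, but the descent in y needs only that
    some scalar in its expression is not.\<close>
  define a0 where "a0 = (LEAST a. a \<le> n \<and> (\<exists>b\<le>n. c (a, b) \<noteq> 0))"
  have a0: "a0 \<le> n \<and> (\<exists>b\<le>n. c (a0, b) \<noteq> 0)"
    unfolding a0_def by (rule LeastI_ex) (use c(1) in auto)
  have "c (a, b) = 0" if "a < a0" "b \<le> n" for a b
    using not_less_Least[OF that(1)[unfolded a0_def]] that a0 by auto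
  then have "g a = 0" if "a < a0" for a
    using that by (simp add: g_def mconst_arith)
  then have "g a0 \<in> Q1"
    by (intro lowest_coeff_mem_ideal[OF Q(1) Q1.is_ideal _ x gc g0]) (use sub a0 in auto)
  \<comment> \<open>The same descent, now with constants as coefficients and y in place of x, places
    a nonzero scalar, hence a unit, in \<open>Q2\<close>.\<close>
  moreover define b0 where "b0 = (LEAST b. b \<le> n \<and> c (a0, b) \<noteq> 0)"
  have b0: "b0 \<le> n \<and> c (a0, b0) \<noteq> 0"
    unfolding b0_def by (rule LeastI_ex) (use a0 in auto)
  have "c (a0, b) = 0" if "b < b0" for b
    using not_less_Least[OF that(1)[unfolded b0_def]] that b0 by auto
  then have "mconst (c (a0, b)) = 0" if "b < b0" for b
    using that by (simp add: mconst_arith)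
  ultimately have "mconst (c (a0, b0)) \<in> Q2"
    using sub b0 unfolding g_def
    by (intro lowest_coeff_mem_ideal[OF Q(2) Q2.is_ideal _ y, of "\<lambda>b. mconst (c (a0, b))"] mconst_carrier) auto
  from Q2.I_l_closed[OF this mconst_carrier[of "inverse (c (a0, b0))"]]
  have "\<one>\<^bsub>poly_ring s\<^esub> \<in> Q2" using b0 by (simp flip: mconst_arith)
  then show False using Q2.one_imp_carrier Q2.I_notcarr by simp
qed

text \<open>The target is the group algebra of \<int>, that is, Laurent polynomials in one variable.
  It has no zero divisors, so the kernel of this homomorphism is prime.\<close>

lemma primeideal_push_kernel:
  fixes \<psi> :: "(nat \<Rightarrow>\<^sub>0 nat) \<Rightarrow> int"
  assumes \<psi>: "\<And>m n. \<psi> (m + n) = \<psi> m + \<psi> n"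
  shows "primeideal {p \<in> carrier (poly_ring s). push \<psi> p = (0 :: _ \<Rightarrow>\<^sub>0 'k::field)} (poly_ring s)" (is "primeideal ?K _")
proof -
  interpret P: cring "poly_ring s :: 'k mpoly ring" by (rule cring_poly_ring)
  have \<psi>0: "\<psi> 0 = 0" using \<psi>[of 0 0] by simp
  have one: "push \<psi> 1 = (1 :: _ \<Rightarrow>\<^sub>0 'k)" unfolding single_one[symmetric] by (simp add: \<psi>0 del: single_one)
  have sub: "subgroup ?K (add_monoid (poly_ring s))"
  proof (rule P.add.subgroupI)
    show "?K \<noteq> {}" using poly_ring_closed(5) by force
  qed (auto simp: poly_ring_closed push_add push_minus simp flip: a_inv_def simp: poly_ring_minus)
  show ?thesis
  proof (rule primeidealI[OF idealI[OF P.ring_axioms sub] P.cring_axioms])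
    show "carrier (poly_ring s) \<noteq> ?K" using one poly_ring_closed(6) by force
  qed (auto simp: push_mult_hom[OF \<psi>] poly_ring_closed)
qed

text \<open>The chain of two primes consists of the kernels for \<psi> and for the zero map; the
  latter is the ideal of polynomials vanishing at (1, ..., 1). The binomial t^m0 - 1 lies in the
  second but not in the first.\<close>

lemma krull_dim_Quot_nf_ideal:
  fixes \<psi> :: "(nat \<Rightarrow>\<^sub>0 nat) \<Rightarrow> int"
  assumes bound: "\<And>d. card (standard d) \<le> C * (d + 1)"
    and \<psi>: "\<And>m n. \<psi> (m + n) = \<psi> m + \<psi> n" "\<And>m. m \<in> exponents s \<Longrightarrow> \<psi> (\<rho> m) = \<psi> m"
    and m0: "m0 \<in> exponents s" "\<psi> m0 \<noteq> 0"
  shows "krull_dim (poly_ring s Quot (nf_ideal :: 'k::field mpoly set)) = 1"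
proof -
  define K where "K \<psi> = {p \<in> carrier (poly_ring s). push \<psi> p = (0 :: _ \<Rightarrow>\<^sub>0 'k)}" for \<psi> :: "_ \<Rightarrow> int"
  let ?S = "{enat n | n Q. (\<forall>i\<le>n. primeideal (Q i) (poly_ring s) \<and> (nf_ideal :: 'k mpoly set) \<subseteq> Q i) \<and> (\<forall>i<n. Q i \<subset> Q (Suc i))}"
  have KI: "nf_ideal \<subseteq> K \<psi>"
  proof
    fix p :: "'k mpoly" assume p: "p \<in> nf_ideal"
    have "push \<psi> p = push (\<psi> \<circ> \<rho>) p"
      by (rule push_cong) (use p \<psi>(2) in \<open>auto simp: nf_ideal_def carrier_poly_ring\<close>)
    also have "\<dots> = 0" using p by (simp add: nf_ideal_def flip: push_push)
    finally show "p \<in> K \<psi>" using p by (simp add: K_def nf_ideal_def)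
  qed
  have K0: "K \<psi> \<subseteq> K (\<lambda>_. 0)"
  proof
    fix p :: "'k mpoly" assume p: "p \<in> K \<psi>"
    have "push (\<lambda>_. 0::int) p = push (\<lambda>_. 0) (push \<psi> p)" by (simp add: push_push o_def)
    then show "p \<in> K (\<lambda>_. 0)" using p by (simp add: K_def)
  qed
  define p where "p = Poly_Mapping.single m0 (1::'k) - Poly_Mapping.single 0 1"
  have "p \<in> carrier (poly_ring s)" unfolding p_def by (intro poly_ring_closed m0 exponents_zero)
  moreover have "\<psi> 0 = 0" using \<psi>(1)[of 0 0] by simp
  moreover have "Poly_Mapping.single (\<psi> m0) (1::'k) \<noteq> Poly_Mapping.single 0 1"
    using m0(2) by (metis lookup_single_eq lookup_single_not_eq zero_neq_one)
  ultimately have "p \<in> K (\<lambda>_. 0)" "p \<notin> K \<psi>"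
    by (auto simp: K_def p_def push_diff simp del: single_one)
  then have psub: "K \<psi> \<subset> K (\<lambda>_. 0)" using K0 by blast
  let ?Q = "\<lambda>i. if i = (0::nat) then K \<psi> else K (\<lambda>_. 0)"
  have "enat 1 \<in> ?S"
    using KI psub primeideal_push_kernel[of \<psi>, where ?'k = 'k] \<psi>(1) primeideal_push_kernel[of "\<lambda>_. 0", where ?'k = 'k]
    by (intro CollectI exI[of _ 1] exI[of _ ?Q]) (auto simp: K_def[symmetric])
  then have "1 \<le> Sup ?S" by (simp add: Sup_upper one_enat_def)
  moreover have "Sup ?S \<le> 1"
  proof (rule Sup_least)
    fix z assume "z \<in> ?S"
    then obtain n Q where z: "z = enat n"
      and Q: "\<And>i. i \<le> n \<Longrightarrow> primeideal (Q i) (poly_ring s) \<and> (nf_ideal :: 'k mpoly set) \<subseteq> Q i"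
      and QS: "\<And>i. i < n \<Longrightarrow> Q i \<subset> Q (Suc i)" by blast
    have "n \<le> 1"
    proof (rule ccontr)
      assume "\<not> n \<le> 1"
      then show False
        using no_prime_chain_of_length_2[OF bound, of "Q 0" "Q 1" "Q 2"] Q[of 0] Q[of 1] Q[of 2] QS[of 0] QS[of 1]
        by (simp add: numeral_2_eq_2)
    qed
    then show "z \<le> 1" by (simp add: z one_enat_def)
  qed
  moreover have "krull_dim (poly_ring s Quot (nf_ideal :: 'k mpoly set)) = Sup ?S"
    by (rule krull_dim_Quot[OF cring_poly_ring ideal_nf_ideal])
  ultimately show ?thesis by (simp add: order.antisym)
qed

end

section \<open>Lattice ideals\<close>

text \<open>Span and dependence refer to coefficient functions on a set of vectors, the determinant
  arguments to coordinates. Because \<alpha> is distinct, a coordinate vector can be read as such a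
  function without merging entries.\<close>

lemma Z_basis_mat_of_cols:
  assumes lattice: "subgroup L (monoid_vec TYPE(int) n)" and basis: "is_Z_basis n L \<alpha>"
  shows "L = {mat_of_cols n \<alpha> *\<^sub>v y | y. y \<in> carrier_vec (length \<alpha>)}" (is "L = ?R")
    and "\<And>y. y \<in> carrier_vec (length \<alpha>) \<Longrightarrow> mat_of_cols n \<alpha> *\<^sub>v y = 0\<^sub>v n \<Longrightarrow> y = 0\<^sub>v (length \<alpha>)"
proof -
  interpret V: idom_vec n "TYPE(int)" .
  have Lc: "L \<subseteq> carrier_vec n" using subgroup.subset[OF lattice] by (simp add: monoid_vec_def)
  have sub: "set \<alpha> \<subseteq> carrier_vec n" and dist: "distinct \<alpha>" and ind: "V.lin_indpt (set \<alpha>)"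
    and span: "V.span (set \<alpha>) = L"
    using basis Lc by (auto simp: is_Z_basis_def)
  have dim: "\<forall>w\<in>set \<alpha>. dim_vec w = n" using sub by auto
  have mult: "V.lincomb_list (\<lambda>i. y $ i) \<alpha> = mat_of_cols n \<alpha> *\<^sub>v y" if "y \<in> carrier_vec (length \<alpha>)" for y
  proof -
    have "vec (length \<alpha>) (\<lambda>i. y $ i) = y" using that by (intro eq_vecI) auto
    then show ?thesis using V.lincomb_list_as_mat_mult[OF dim] by metis
  qed
  have "L = V.span_list \<alpha>" using V.span_list_as_span[OF sub] span by simp
  also have "\<dots> = {V.lincomb_list c \<alpha> | c. True}" by (auto simp: V.span_list_def)
  also have "\<dots> = ?R"
  proof (intro equalityI subsetI)
    fix x assume "x \<in> {V.lincomb_list c \<alpha> | c. True}"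
    then show "x \<in> ?R" using V.lincomb_list_as_mat_mult[OF dim] by fastforce
  next
    fix x assume "x \<in> ?R"
    then obtain y where "y \<in> carrier_vec (length \<alpha>)" "x = mat_of_cols n \<alpha> *\<^sub>v y" by blast
    then have "x = V.lincomb_list (\<lambda>i. y $ i) \<alpha>" using mult by simp
    then show "x \<in> {V.lincomb_list c \<alpha> | c. True}" by blast
  qed
  finally show "L = ?R" .
  fix y :: "int vec" assume y: "y \<in> carrier_vec (length \<alpha>)" "mat_of_cols n \<alpha> *\<^sub>v y = 0\<^sub>v n"
  define f where "f = (\<lambda>w. y $ inv_into {..<length \<alpha>} ((!) \<alpha>) w)"
  have inj: "inj_on ((!) \<alpha>) {..<length \<alpha>}" using dist by (auto simp: inj_on_def nth_eq_iff_index_eq)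
  have f: "f (\<alpha> ! i) = y $ i" if "i < length \<alpha>" for i
    using that inj by (simp add: f_def)
  have "V.lincomb f (set \<alpha>) = V.lincomb_list (\<lambda>i. f (\<alpha> ! i)) \<alpha>"
    by (rule V.lincomb_as_lincomb_list_distinct[OF sub dist])
  also have "\<dots> = mat_of_cols n \<alpha> *\<^sub>v vec (length \<alpha>) (\<lambda>i. f (\<alpha> ! i))"
    by (rule V.lincomb_list_as_mat_mult[OF dim])
  also have "vec (length \<alpha>) (\<lambda>i. f (\<alpha> ! i)) = y" using y(1) f by (intro eq_vecI) auto
  finally have "V.lincomb f (set \<alpha>) = 0\<^sub>v n" using y(2) by simp
  then have "f w = 0" if "w \<in> set \<alpha>" for w
    using ind that unfolding V.lin_dep_def by auto
  then show "y = 0\<^sub>v (length \<alpha>)" using f y(1) by (intro eq_vecI) auto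
qed

section \<open>Exponents as integer vectors\<close>

definition evec :: "nat \<Rightarrow> (nat \<Rightarrow>\<^sub>0 nat) \<Rightarrow> int vec" where
  "evec s m = vec s (\<lambda>j. int (Poly_Mapping.lookup m j))"

definition of_exponents :: "nat \<Rightarrow> (nat \<Rightarrow> nat) \<Rightarrow> (nat \<Rightarrow>\<^sub>0 nat)" where
  "of_exponents s c = (\<Sum>j<s. Poly_Mapping.single j (c j))"

lemma lookup_of_exponents: "Poly_Mapping.lookup (of_exponents s c) j = (if j < s then c j else 0)"
  by (auto simp: of_exponents_def lookup_sum lookup_single when_def)

lemma of_exponents_in: "of_exponents s c \<in> exponents s"
  by (auto simp: exponents_def in_keys_iff lookup_of_exponents split: if_splits)

lemma exponents_eqI:
  assumes "m \<in> exponents s" "n \<in> exponents s" "\<And>j. j < s \<Longrightarrow> Poly_Mapping.lookup m j = Poly_Mapping.lookup n j"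
  shows "m = n"
  using assms by (intro poly_mapping_eqI) (metis exponents_def in_keys_iff lessThan_iff mem_Collect_eq subset_iff)

lemma evec_carrier [simp]: "evec s m \<in> carrier_vec s"
  and dim_evec [simp]: "dim_vec (evec s m) = s"
  and evec_index [simp]: "j < s \<Longrightarrow> evec s m $ j = int (Poly_Mapping.lookup m j)"
  by (simp_all add: evec_def)

lemma evec_add: "evec s (m + n) = evec s m + evec s n"
  by (intro eq_vecI) (auto simp: evec_def lookup_add)

lemma mpower_eq_single: "mpower s c = (Poly_Mapping.single (of_exponents s c) 1 :: 'k::field mpoly)"
proof -
  have pow: "mvar j ^ n = (Poly_Mapping.single (Poly_Mapping.single j n) 1 :: 'k mpoly)" for j n
    by (induction n) (simp_all add: mvar_def mult_single flip: single_add)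
  show ?thesis unfolding mpower_def of_exponents_def
    by (induction s) (simp_all add: pow mult_single)
qed

section \<open>Lattice ideals through representatives of least degree\<close>

context corank_one_lattice
begin

abbreviation cong :: "(nat \<Rightarrow>\<^sub>0 nat) \<Rightarrow> (nat \<Rightarrow>\<^sub>0 nat) \<Rightarrow> bool" where
  "cong m' n \<equiv> evec (Suc m) m' - evec (Suc m) n \<in> L"

lemma cong_refl: "cong a a"
proof -
  have "evec (Suc m) a - evec (Suc m) a = 0\<^sub>v (Suc m)" by (intro eq_vecI) auto
  then show ?thesis using L_zero by (simp only:)
qed

lemma cong_right: "cong a b \<Longrightarrow> cong c b \<Longrightarrow> cong a c"
proof -
  assume "cong a b" "cong c b"
  from L_diff[OF this] show "cong a c"
    by (rule back_subst[of "\<lambda>x. x \<in> L"]) (intro eq_vecI, auto simp: evec_def)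
qed

lemma cong_sym: "cong a b \<Longrightarrow> cong b a"
  using cong_right[OF cong_refl] .

lemma cong_trans: "cong a b \<Longrightarrow> cong b c \<Longrightarrow> cong a c"
  using cong_right cong_sym by blast

text \<open>Several exponents of a class may share the least degree. The choice made by
  \<open>arg_min\<close> depends only on the predicate, which is the same for congruent exponents,
  so it is constant on classes.\<close>

definition min_rep :: "(nat \<Rightarrow>\<^sub>0 nat) \<Rightarrow> (nat \<Rightarrow>\<^sub>0 nat)" where
  "min_rep a = arg_min mdeg (\<lambda>n. n \<in> exponents (Suc m) \<and> cong n a)"

lemma min_rep:
  assumes "a \<in> exponents (Suc m)"
  shows "min_rep a \<in> exponents (Suc m)" "cong (min_rep a) a" "mdeg (min_rep a) \<le> mdeg a"
proof -
  have a: "a \<in> exponents (Suc m) \<and> cong a a" using assms cong_refl by simp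
  show "min_rep a \<in> exponents (Suc m)" "cong (min_rep a) a"
    using arg_min_natI[of "\<lambda>n. n \<in> exponents (Suc m) \<and> cong n a", OF a, of mdeg] by (simp_all add: min_rep_def)
  show "mdeg (min_rep a) \<le> mdeg a"
    unfolding min_rep_def using arg_min_nat_le[of "\<lambda>n. n \<in> exponents (Suc m) \<and> cong n a", OF a, of mdeg] by simp
qed

lemma min_rep_eq_iff:
  assumes "a \<in> exponents (Suc m)" "b \<in> exponents (Suc m)"
  shows "min_rep a = min_rep b \<longleftrightarrow> cong a b"
proof
  assume "min_rep a = min_rep b"
  then show "cong a b" using min_rep(2)[OF assms(1)] min_rep(2)[OF assms(2)] cong_sym cong_trans by metis
next
  assume "cong a b"
  then have "cong n a \<longleftrightarrow> cong n b" for n using cong_sym cong_trans by blast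
  then show "min_rep a = min_rep b" unfolding min_rep_def by simp
qed

text \<open>Congruence modulo \<open>L\<close> is invariant under translation, which gives
  \<open>add\<close>; an exponent competes in the minimum over its own class, which gives
  \<open>deg\<close>.\<close>

sublocale monomial_normal_form "Suc m" min_rep
proof
  fix a b assume ab: "a \<in> exponents (Suc m)" "b \<in> exponents (Suc m)"
  have "evec (Suc m) (a + min_rep b) - evec (Suc m) (a + b) = evec (Suc m) (min_rep b) - evec (Suc m) b"
    by (intro eq_vecI) (auto simp: evec_def lookup_add)
  then show "min_rep (a + min_rep b) = min_rep (a + b)"
    using min_rep[OF ab(2)] ab by (subst min_rep_eq_iff) (auto intro: exponents_add)
qed (use min_rep in auto)

text \<open>The two monomials of a generator are congruent, so generators reduce to zero.
  Conversely, a binomial of congruent monomials is a generator times the greatest common divisor of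
  the two monomials.\<close>

lemma lattice_ideal_eq_nf_ideal: "lattice_ideal (Suc m) L = (nf_ideal :: 'k::field mpoly set)"
proof
  interpret P: cring "poly_ring (Suc m) :: 'k mpoly ring" by (rule cring_poly_ring)
  let ?s = "Suc m"
  let ?G = "{mpower ?s (\<lambda>j. nat (a $ j)) - mpower ?s (\<lambda>j. nat (- (a $ j))) :: 'k mpoly | a. a \<in> L}"
  have G: "?G \<subseteq> carrier (poly_ring ?s)"
    by (auto simp: mpower_eq_single intro!: poly_ring_closed of_exponents_in)
  have "?G \<subseteq> nf_ideal"
  proof clarify
    fix a assume a: "a \<in> L"
    let ?p = "of_exponents ?s (\<lambda>j. nat (a $ j))" and ?n = "of_exponents ?s (\<lambda>j. nat (- (a $ j)))"
    have "evec ?s ?p - evec ?s ?n = a"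
      using L_carrier[OF a] by (intro eq_vecI) (auto simp: lookup_of_exponents evec_def)
    then have "min_rep ?p = min_rep ?n" using a by (simp add: min_rep_eq_iff of_exponents_in)
    then show "mpower ?s (\<lambda>j. nat (a $ j)) - mpower ?s (\<lambda>j. nat (- (a $ j))) \<in> (nf_ideal :: 'k mpoly set)"
      by (auto simp: nf_ideal_def mpower_eq_single push_diff intro!: poly_ring_closed of_exponents_in)
  qed
  then show "lattice_ideal ?s L \<subseteq> (nf_ideal :: 'k mpoly set)"
    unfolding lattice_ideal_def by (rule P.genideal_minimal[OF ideal_nf_ideal])
  interpret J: ideal "lattice_ideal ?s L :: 'k mpoly set" "poly_ring ?s"
    unfolding lattice_ideal_def by (rule P.genideal_ideal[OF G])
  show "nf_ideal \<subseteq> (lattice_ideal ?s L :: 'k mpoly set)"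
  proof (rule nf_ideal_subset_ideal[OF J.is_ideal])
    fix n assume n: "n \<in> exponents ?s"
    define a where "a = evec ?s n - evec ?s (min_rep n)"
    \<comment> \<open>The exponent of that divisor. Once it is removed, the supports are disjoint
      and the exponents left are the positive and negative parts of \<open>a\<close>.\<close>
    define g where "g = of_exponents ?s (\<lambda>j. min (Poly_Mapping.lookup n j) (Poly_Mapping.lookup (min_rep n) j))"
    have a: "a \<in> L" unfolding a_def using min_rep(2)[OF n] by (rule cong_sym)
    have "mpower ?s (\<lambda>j. nat (a $ j)) - mpower ?s (\<lambda>j. nat (- (a $ j))) \<in> (lattice_ideal ?s L :: 'k mpoly set)"
      using P.genideal_self[OF G] a unfolding lattice_ideal_def by blast
    moreover have "Poly_Mapping.single g (1::'k) \<in> carrier (poly_ring ?s)"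
      unfolding g_def by (intro poly_ring_closed of_exponents_in)
    ultimately have "Poly_Mapping.single g 1 * (mpower ?s (\<lambda>j. nat (a $ j)) - mpower ?s (\<lambda>j. nat (- (a $ j)))) \<in> (lattice_ideal ?s L :: 'k mpoly set)"
      using J.I_l_closed by simp
    moreover have "g + of_exponents ?s (\<lambda>j. nat (a $ j)) = n"
      unfolding g_def by (rule exponents_eqI[of _ ?s]) (auto simp: n of_exponents_in lookup_add lookup_of_exponents a_def intro!: exponents_add)
    moreover have "g + of_exponents ?s (\<lambda>j. nat (- (a $ j))) = min_rep n"
      unfolding g_def by (rule exponents_eqI[of _ ?s]) (auto simp: min_rep(1)[OF n] of_exponents_in lookup_add lookup_of_exponents a_def intro!: exponents_add)
    ultimately show "Poly_Mapping.single n 1 - Poly_Mapping.single (min_rep n) 1 \<in> (lattice_ideal ?s L :: 'k mpoly set)"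
      by (simp add: mpower_eq_single right_diff_distrib mult_single)
  qed
qed

text \<open>Exponents of degree at most d are the integer points of the simplex. Transported to
  them, \<open>min_rep\<close> identifies exactly the points congruent modulo
  \<open>L\<close>.\<close>

lemma card_standard:
  "\<exists>d0. \<forall>d. nat (vmax - vmin) * (d + 1 - d0) \<le> card (standard d) \<and> card (standard d) \<le> nat (vmax - vmin) * (d + 1)"
proof -
  let ?s = "Suc m"
  define f where "f = (\<lambda>x :: int vec. min_rep (of_exponents ?s (\<lambda>j. nat (x $ j))))"
  have ev: "evec ?s (of_exponents ?s (\<lambda>j. nat (x $ j))) = x" if "x \<in> simplex d" for x d
    using that by (intro eq_vecI) (auto simp: simplex_def lookup_of_exponents evec_def)
  have "f x = f y \<longleftrightarrow> x - y \<in> L" if "x \<in> simplex d" "y \<in> simplex d" for x y d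
    unfolding f_def by (simp add: min_rep_eq_iff of_exponents_in ev[OF that(1)] ev[OF that(2)])
  moreover have "f ` simplex d = standard d" for d
  proof -
    have md: "int (mdeg n) = (\<Sum>j<?s. evec ?s n $ j)" if "n \<in> exponents ?s" for n
      using mdeg_superset[of "{..<?s}" n] that by (simp add: exponents_def del: sum.lessThan_Suc)
    have "min_rep n \<in> f ` simplex d" if n: "n \<in> exponents ?s" "mdeg n \<le> d" for n
    proof (rule image_eqI)
      show "evec ?s n \<in> simplex d" using md[OF n(1)] n(2) by (simp add: simplex_def del: sum.lessThan_Suc)
      have "of_exponents ?s (\<lambda>j. nat (evec ?s n $ j)) = n"
        by (rule exponents_eqI[of _ ?s]) (auto simp: n of_exponents_in lookup_of_exponents)
      then show "min_rep n = f (evec ?s n)" by (simp add: f_def)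
    qed
    moreover have "f x \<in> standard d" if x: "x \<in> simplex d" for x
      unfolding f_def standard_def
    proof (intro imageI CollectI conjI of_exponents_in)
      show "mdeg (of_exponents ?s (\<lambda>j. nat (x $ j))) \<le> d"
        using md[OF of_exponents_in, of "\<lambda>j. nat (x $ j)"] x unfolding ev[OF x]
        by (simp add: simplex_def del: sum.lessThan_Suc)
    qed
    ultimately show ?thesis by (auto simp: standard_def)
  qed
  ultimately show ?thesis using card_simplex_classes by metis
qed

text \<open>The form \<phi> is constant on classes modulo \<open>L\<close>, and a nonvanishing minor
  names a variable on which it is nonzero.\<close>

lemma krull_dim_lattice_ring:
  "krull_dim (poly_ring (Suc m) Quot (lattice_ideal (Suc m) L :: 'k::field mpoly set)) = 1"
proof -
  obtain j where j: "j < Suc m" "v (Suc j) \<noteq> 0" using minors_not_all_zero by blast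
  show ?thesis
    unfolding lattice_ideal_eq_nf_ideal
  proof (rule krull_dim_Quot_nf_ideal)
    show "card (standard d) \<le> nat (vmax - vmin) * (d + 1)" for d using card_standard by blast
    show "\<phi> (evec (Suc m) (a + b)) = \<phi> (evec (Suc m) a) + \<phi> (evec (Suc m) b)" for a b
      by (simp add: evec_add \<phi>_add)
    show "\<phi> (evec (Suc m) (min_rep a)) = \<phi> (evec (Suc m) a)" if "a \<in> exponents (Suc m)" for a
      using \<phi>_L[OF min_rep(2)[OF that]] by (simp add: \<phi>_diff)
    show "Poly_Mapping.single j 1 \<in> exponents (Suc m)" using j by (simp add: exponents_def)
    have "evec (Suc m) (Poly_Mapping.single j 1) = unit_vec (Suc m) j"
      using j by (intro eq_vecI) (auto simp: evec_def lookup_single when_def)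
    then show "\<phi> (evec (Suc m) (Poly_Mapping.single j 1)) \<noteq> 0" using \<phi>_unit_vec j by simp
  qed
qed

lemma quotient_degree_lattice_ideal:
  "quotient_degree (Suc m) (lattice_ideal (Suc m) L :: 'k::field mpoly set) = real_of_int (vmax - vmin)"
proof -
  define D where "D = real_of_int (vmax - vmin)"
  have D: "real (nat (vmax - vmin)) = D" "0 \<le> D" using vmin_less_vmax by (simp_all add: D_def)
  obtain d0 where d0: "\<And>d. nat (vmax - vmin) * (d + 1 - d0) \<le> card (standard d)"
    "\<And>d. card (standard d) \<le> nat (vmax - vmin) * (d + 1)" using card_standard by blast
  \<comment> \<open>Over the reals the subtraction is not truncated; its value, possibly negative,
    is at most the truncated one.\<close>
  have lower: "D * (real d + 1 - real d0) \<le> real (card (standard d))" for d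
  proof -
    have "D * (real d + 1 - real d0) \<le> D * real (d + 1 - d0)" using D(2) by (intro mult_left_mono) linarith+
    also have "\<dots> = real (nat (vmax - vmin) * (d + 1 - d0))" using D(1) by simp
    also have "\<dots> \<le> real (card (standard d))" using d0(1) of_nat_mono by blast
    finally show ?thesis .
  qed
  have upper: "real (card (standard d)) \<le> D * (real d + 1)" for d
  proof -
    have "real (card (standard d)) \<le> real (nat (vmax - vmin) * (d + 1))" using d0(2) of_nat_mono by blast
    then show ?thesis using D(1) by (simp add: algebra_simps)
  qed
  have lim: "(\<lambda>i. D + c / real i) \<longlonglongrightarrow> D" for c
    using tendsto_add[OF tendsto_const lim_const_over_n[of c], of D] by simp
  have "(\<lambda>i. real (card (standard i)) / real i) \<longlonglongrightarrow> D"
  proof (rule tendsto_sandwich[OF _ _ lim[of "D * (1 - real d0)"] lim[of D]])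
    show "\<forall>\<^sub>F i in sequentially. D + D * (1 - real d0) / real i \<le> real (card (standard i)) / real i"
      \<comment> \<open>At i = 0 division by zero returns 0 and this estimate fails, since D is
        positive.\<close>
      using eventually_gt_at_top[of 0]
    proof eventually_elim
      case (elim i)
      then have "D + D * (1 - real d0) / real i = (D * (real i + 1 - real d0)) / real i"
        by (simp add: field_simps)
      then show ?case using lower[of i] elim by (simp add: divide_right_mono)
    qed
    show "\<forall>\<^sub>F i in sequentially. real (card (standard i)) / real i \<le> D + D / real i"
      using eventually_gt_at_top[of 0]
    proof eventually_elim
      case (elim i)
      then have "D + D / real i = (D * (real i + 1)) / real i"
        by (simp add: field_simps)
      then show ?case using upper[of i] elim by (simp add: divide_right_mono)
    qed
  qed
  then have "lim (\<lambda>i. real (card (standard i)) / real i) = D" by (rule limI)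
  moreover have "the_enat 1 = 1" by (simp add: one_enat_def)
  ultimately show ?thesis
    unfolding quotient_degree_def krull_dim_lattice_ring unfolding lattice_ideal_eq_nf_ideal affine_hilbert_nf_ideal
    by (simp add: D_def)
qed

end

theorem corollary4p10:
  fixes s :: nat
    and L :: "int vec set"
    and \<alpha> :: "int vec list"
    and B :: "int mat"
    and v :: "nat \<Rightarrow> int"
  assumes s: "s \<ge> 1"
    and lattice: "subgroup L (monoid_vec TYPE(int) s)"
    and rank: "length \<alpha> = s - 1"
    and basis: "is_Z_basis s L \<alpha>"
    and B: "B = mat_of_cols s \<alpha>"
    and v: "\<And>i. i \<in> {1..s} \<Longrightarrow> v i = (-1) ^ i * det (submatrix B (- {i - 1}) UNIV)"
  shows "quotient_degree s (lattice_ideal s L :: 'k::field mpoly set) =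
    real_of_int (Max (insert 0 (v ` {1..s})) - Min (insert 0 (v ` {1..s})))"
proof -
  obtain m where m: "s = Suc m" using s by (cases s) auto
  have len: "length \<alpha> = m" using rank m by simp
  have B': "B = mat_of_cols (Suc m) \<alpha>" using B m by simp
  note Z_basis = Z_basis_mat_of_cols[OF lattice basis, unfolded m len, folded B']
  interpret corank_one_lattice m B v
  proof
    show "B \<in> carrier_mat (Suc m) m" unfolding B' using len by (metis mat_of_cols_carrier(1))
    show "y = 0\<^sub>v m" if "y \<in> carrier_vec m" "B *\<^sub>v y = 0\<^sub>v (Suc m)" for y
      using that by (rule Z_basis(2))
    show "v i = (-1) ^ i * det (submatrix B (- {i - 1}) UNIV)" if "i \<in> {1..Suc m}" for i
      using v[of i] that unfolding m .
  qed
  \<comment> \<open>Inside the locale the lattice is the column image of \<open>B\<close>; the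
    spanning half of the basis property identifies it with the given one.\<close>
  have "corank_one_lattice.L m B = L"
    unfolding L_def using Z_basis(1) by (rule sym)
  then show ?thesis
    using quotient_degree_lattice_ideal[where ?'k = 'k] unfolding vmax_def vmin_def m by simp
qed

end
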